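(* Let $q$ be a natural number with $2\le q\le 60$, and let $k$ be an integer with $\gcd(k,q)=1$. Then $k/q$ is the value of a normalized Dedekind sum if and only if $k$ satisfies both of the following conditions: (a) if $3\nmid q$, then $k\equiv 0\pmod 3$; (b) if $2\nmid q$, then $k\equiv 2\pmod 4$ if $q\equiv 3\pmod 4$; $k\equiv 0\pmod 8$ if $q$ is a perfect square; and $k\equiv 0\pmod 4$ otherwise.
   Context: For $x\in\mathbb{R}$ let $((x))=x-\lfloor x\rfloor-1/2$ if $x\notin\mathbb{Z}$ and $((x))=0$ if $x\in\mathbb{Z}$. For $a\in\mathbb{Z}$, $b\in\mathbb{N}$ with $\gcd(a,b)=1$, the classical Dedekind sum is $s(a,b)=\sum_{j=1}^{b}((j/b))((aj/b))$, and the normalized Dedekind sum is $S(a,b)=12\,s(a,b)$. A rational number is "the value of a normalized Dedekind sum" if it equals $S(a,b)$ for some such $a,b$. *)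

theory Defs
  imports Complex_Main "HOL-Number_Theory.Cong"
begin

definition sawtooth :: "real \<Rightarrow> real" where
  "sawtooth x = (if x \<in> \<int> then 0 else x - of_int \<lfloor>x\<rfloor> - 1 / 2)"

definition dedekind_sum :: "int \<Rightarrow> nat \<Rightarrow> real" where
  "dedekind_sum a b =
     (\<Sum>j = 1..b. sawtooth (real j / real b) * sawtooth (of_int a * real j / real b))"

definition normalized_dedekind_sum :: "int \<Rightarrow> nat \<Rightarrow> real" where
  "normalized_dedekind_sum a b = 12 * dedekind_sum a b"

definition is_normalized_dedekind_value :: "real \<Rightarrow> bool" where
  "is_normalized_dedekind_value r \<longleftrightarrow>
     (\<exists>(a :: int) (b :: nat). b \<ge> 1 \<and> coprime a (int b) \<and> r = normalized_dedekind_sum a b)"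

end

theory Submission
  imports Defs
begin

text \<open>Write \<open>S = 12 s\<close>. From the reciprocity law one gets Rademacher's integer valued function
  \<open>\<Phi>(a, b; c, d) = (a + d)/c - sgn c S(d, |c|)\<close> on the modular group, with the composition law
  \<open>\<Phi>(M N) = \<Phi>(M) + \<Phi>(N) - 3 sgn(c\<^sub>M c\<^sub>N c\<^sub>M\<^sub>N)\<close>.

  Integrality of \<open>\<Phi>\<close> shows that \<open>S(d, b) = k/q\<close> in lowest terms forces \<open>b = q g\<close> with \<open>g | d\<^sup>2 + 1\<close>. Hence \<open>3\<close> does
  not divide \<open>g\<close>, and \<open>3 | b\<^sup>2 S(d, b)\<close> gives condition (a). For odd \<open>q\<close> take \<open>d\<close> odd and positive; since
  \<open>S(d, g) = 0\<close>, reciprocity for \<open>(d, q g)\<close> and \<open>(d, g)\<close> expresses \<open>k\<close> by \<open>d S(q g, d)\<close> and \<open>d S(g, d)\<close>, which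
  Gauss's lemma determines modulo \<open>8\<close>; this gives condition (b).

  Conversely, if \<open>k/q\<close> is a value and \<open>s (s + k r) \<equiv> 1 (mod q)\<close>, conjugating in the modular group shows that
  \<open>k/q \<plusminus> (S(s, q r) - S(s + k r, q r))\<close> are values too. The shift depends only on \<open>k\<close> modulo \<open>q\<close>, so it can be
  iterated. For each \<open>q \<le> 60\<close> and each residue of \<open>k\<close> modulo \<open>q\<close> at most three explicit shifts generate all multiples
  of \<open>3\<^sup>i 8\<^sup>j\<close>, where \<open>i = 1\<close> iff \<open>3\<close> does not divide \<open>q\<close> and \<open>j = 1\<close> iff \<open>q\<close> is odd, and at most two explicit Dedekind
  sums start the orbits.\<close>

section \<open>Reciprocity\<close>

abbreviation ndsum :: "int \<Rightarrow> nat \<Rightarrow> real" where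
  "ndsum \<equiv> normalized_dedekind_sum"

section \<open>Dedekind sums with denominators cleared\<close>

lemma sawtooth_of_int_div:
  fixes m :: int and b :: nat
  assumes "b > 0"
  shows "sawtooth (of_int m / real b) =
    (if int b dvd m then 0 else of_int (m mod int b) / real b - 1 / 2)"
proof (cases "int b dvd m")
  case True
  then obtain c where "m = int b * c" by blast
  then have "of_int m / real b = of_int c" using assms by simp
  then show ?thesis using True by (simp add: sawtooth_def)
next
  case False
  have "of_int m / real b \<notin> \<int>"
  proof
    assume "of_int m / real b \<in> \<int>"
    then obtain c where "of_int m / real b = of_int c" by (auto elim: Ints_cases)
    then have "real_of_int m = of_int (c * int b)" using assms by (simp add: field_simps)
    then have "m = c * int b" by (simp only: of_int_eq_iff)
    with False show False by simp
  qed
  moreover have "\<lfloor>of_int m / real b\<rfloor> = m div int b"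
    using floor_divide_of_int_eq[of m "int b", where ?'a = real] by simp
  moreover have "real_of_int m = of_int (m div int b) * real b + of_int (m mod int b)"
    by (metis div_mult_mod_eq of_int_add of_int_mult of_int_of_nat_eq)
  ultimately show ?thesis using False assms by (simp add: sawtooth_def field_simps)
qed

text \<open>For coprime \<open>a\<close> and \<open>b\<close> this is \<open>4 b^2 s(a, b)\<close>:
  each sawtooth factor is multiplied by \<open>2 b\<close>. Reciprocity and the congruences modulo 3
  and 8 are derived from this integer.\<close>

definition centred_sum :: "int \<Rightarrow> nat \<Rightarrow> int" where
  "centred_sum a b = (\<Sum>j = 1..<b. (2 * int j - int b) * (2 * ((a * int j) mod int b) - int b))"

text \<open>The term \<open>j = b\<close> vanishes. For the other \<open>j\<close>, coprimality
  keeps \<open>a j\<close> away from the multiples of \<open>b\<close>, so both sawtooth factors are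
  given by their linear branch.\<close>

lemma ndsum_centred:
  assumes "b > 0" "coprime a (int b)"
  shows "real b ^ 2 * ndsum a b = of_int (3 * centred_sum a b)"
proof -
  have "{1..b} = insert b {1..<b}" using assms by auto
  moreover have "sawtooth (real b / real b) = 0"
    using sawtooth_of_int_div[OF assms(1), of "int b"] by simp
  ultimately have "ndsum a b = 12 * (\<Sum>j = 1..<b. sawtooth (real j / real b) * sawtooth (of_int a * real j / real b))"
    by (simp add: normalized_dedekind_sum_def dedekind_sum_def)
  also have "(\<Sum>j = 1..<b. sawtooth (real j / real b) * sawtooth (of_int a * real j / real b))
    = (\<Sum>j = 1..<b. (real j / real b - 1/2) * (of_int ((a * int j) mod int b) / real b - 1/2))"
  proof (rule sum.cong)
    fix j assume j: "j \<in> {1..<b}"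
    then have "\<not> int b dvd int j" using zdvd_imp_le by fastforce
    moreover from this have "\<not> int b dvd a * int j"
      using assms by (simp add: coprime_commute coprime_dvd_mult_right_iff)
    moreover have "int j mod int b = int j" using j by simp
    ultimately show "sawtooth (real j / real b) * sawtooth (of_int a * real j / real b) =
      (real j / real b - 1/2) * (of_int ((a * int j) mod int b) / real b - 1/2)"
      using sawtooth_of_int_div[OF assms(1), of "int j"] sawtooth_of_int_div[OF assms(1), of "a * int j"]
      by simp
  qed simp
  finally have *: "ndsum a b = 12 * (\<Sum>j = 1..<b. (real j / real b - 1/2) * (of_int ((a * int j) mod int b) / real b - 1/2))" .
  have "real b ^ 2 * ndsum a b = (\<Sum>j = 1..<b. real b ^ 2 * 12 * ((real j / real b - 1/2) * (of_int ((a * int j) mod int b) / real b - 1/2)))"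
    by (simp add: * sum_distrib_left mult.assoc)
  also have "\<dots> = (\<Sum>j = 1..<b. of_int (3 * ((2 * int j - int b) * (2 * ((a * int j) mod int b) - int b))))"
    using assms(1) by (intro sum.cong) (auto simp: field_simps power2_eq_square)
  also have "\<dots> = of_int (3 * centred_sum a b)"
    by (simp add: centred_sum_def sum_distrib_left)
  finally show ?thesis .
qed

lemma ndsum_cong:
  assumes "[a = a'] (mod int b)" "b > 0"
  shows "ndsum a b = ndsum a' b"
proof -
  have "sawtooth (of_int a * real j / real b) = sawtooth (of_int a' * real j / real b)" for j
  proof -
    have "(a * int j) mod int b = (a' * int j) mod int b"
      using assms(1) by (metis cong_def mod_mult_left_eq)
    moreover from this have "int b dvd a * int j \<longleftrightarrow> int b dvd a' * int j"
      by (simp add: dvd_eq_mod_eq_0)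
    ultimately show ?thesis
      using sawtooth_of_int_div[OF assms(2), of "a * int j"] sawtooth_of_int_div[OF assms(2), of "a' * int j"]
      by simp
  qed
  then show ?thesis by (simp add: normalized_dedekind_sum_def dedekind_sum_def)
qed

lemma ndsum_minus:
  assumes "b > 0"
  shows "ndsum (- a) b = - ndsum a b"
proof -
  have "sawtooth (- x) = - sawtooth x" for x
  proof (cases "x \<in> \<int>")
    case False
    then have "\<lfloor>- x\<rfloor> = - \<lfloor>x\<rfloor> - 1"
      using ceiling_altdef[of x] ceiling_def[of x] by (metis Ints_of_int minus_add_distrib minus_minus uminus_add_conv_diff add.commute)
    then show ?thesis using False by (simp add: sawtooth_def)
  qed (simp add: sawtooth_def)
  then show ?thesis 
    by (simp add: normalized_dedekind_sum_def dedekind_sum_def sum_negf flip: minus_divide_left minus_mult_left)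
qed

section \<open>Floor sums and the reciprocity law\<close>

lemma sum_nat_squares: "6 * (\<Sum>j = 1..<b. (int j)^2) = (int b - 1) * int b * (2 * int b - 1)" if "b > 0"
  using that by (induction b rule: nat_induct_non_zero) (simp_all add: algebra_simps power2_eq_square)

lemma sum_nat_ids: "2 * (\<Sum>j = 1..<b. int j) = (int b - 1) * int b" if "b > 0"
  using that by (induction b rule: nat_induct_non_zero) (simp_all add: algebra_simps)

lemma bij_mult_mod:
  fixes a b :: nat
  assumes "b > 0" "coprime a b"
  shows "bij_betw (\<lambda>j. (a * j) mod b) {1..<b} {1..<b}"
proof -
  have inj: "inj_on (\<lambda>j. (a * j) mod b) {1..<b}"
  proof (rule inj_onI)
    fix x y assume "x \<in> {1..<b}" "y \<in> {1..<b}" "(a * x) mod b = (a * y) mod b"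
    then have "[x = y] (mod b)" using assms(2) by (metis cong_def cong_mult_lcancel_nat)
    then show "x = y" using \<open>x \<in> _\<close> \<open>y \<in> _\<close> by (simp add: cong_def)
  qed
  have "(\<lambda>j. (a * j) mod b) ` {1..<b} \<subseteq> {1..<b}"
  proof safe
    fix j assume j: "j \<in> {1..<b}"
    then have "\<not> b dvd j" by (auto dest: nat_dvd_not_less)
    then have "\<not> b dvd a * j" using assms by (simp add: coprime_commute coprime_dvd_mult_right_iff)
    then show "(a * j) mod b \<in> {1..<b}" using assms by (auto simp: Suc_le_eq dvd_eq_mod_eq_0)
  qed
  with inj show ?thesis
    by (simp add: bij_betw_def endo_inj_surj)
qed

text \<open>Both sides sum \<open>i\<close> over the lattice points \<open>(i, j)\<close> with
  \<open>1 \<le> i < a\<close>, \<open>1 \<le> j < b\<close> and \<open>b i \<le> a j\<close>, once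
  for fixed \<open>j\<close> and once for fixed \<open>i\<close>. By coprimality no such point lies
  on the diagonal \<open>b i = a j\<close>, so for fixed \<open>i\<close> the admissible
  \<open>j\<close> are exactly those above \<open>(b i) div a\<close>.\<close>

lemma sum_floor_triangular:
  fixes a b :: nat
  assumes "a > 0" "b > 0" "coprime a b"
  shows "(\<Sum>j = 1..<b. \<Sum>i = 1..(a * j) div b. int i) =
    (\<Sum>i = 1..<a. int i * (int b - 1 - int ((b * i) div a)))"
proof -
  have "(\<Sum>j = 1..<b. \<Sum>i = 1..(a * j) div b. int i) =
    (\<Sum>j = 1..<b. \<Sum>i = 1..<a. if b * i \<le> a * j then int i else 0)"
  proof (rule sum.cong)
    fix j assume j: "j \<in> {1..<b}"
    have lt: "a * j div b < a" using j assms by (simp add: div_less_iff_less_mult)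
    have iff: "i \<le> (a * j) div b \<longleftrightarrow> b * i \<le> a * j" for i
      using assms(2) by (simp add: less_eq_div_iff_mult_less_eq mult.commute)
    have "{1..(a * j) div b} = {i \<in> {1..<a}. b * i \<le> a * j}"
      unfolding iff[symmetric] using lt by auto
    then show "(\<Sum>i = 1..(a * j) div b. int i) = (\<Sum>i = 1..<a. if b * i \<le> a * j then int i else 0)"
      by (simp only: sum.inter_filter[OF finite_atLeastLessThan])
  qed simp
  also have "\<dots> = (\<Sum>i = 1..<a. \<Sum>j = 1..<b. if b * i \<le> a * j then int i else 0)"
    by (rule sum.swap)
  also have "\<dots> = (\<Sum>i = 1..<a. int i * (int b - 1 - int ((b * i) div a)))"
  proof (rule sum.cong)
    fix i assume i: "i \<in> {1..<a}"
    have nd: "\<not> a dvd b * i"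
      using i assms by (auto simp: coprime_commute coprime_dvd_mult_right_iff dest: nat_dvd_not_less)
    have le: "b * i div a < b" using i assms by (simp add: div_less_iff_less_mult)
    have iff: "b * i \<le> a * j \<longleftrightarrow> (b * i) div a < j" for j
    proof -
      have "b * i \<noteq> a * j" using nd by auto
      then have "b * i \<le> a * j \<longleftrightarrow> b * i < a * j" by auto
      also have "\<dots> \<longleftrightarrow> (b * i) div a < j" using assms by (simp add: div_less_iff_less_mult mult.commute)
      finally show ?thesis .
    qed
    have "{j \<in> {1..<b}. b * i \<le> a * j} = {b * i div a<..<b}" unfolding iff by auto
    then have "(\<Sum>j = 1..<b. if b * i \<le> a * j then int i else 0) = (\<Sum>j\<in>{b * i div a<..<b}. int i)"
      by (simp only: sum.inter_filter[OF finite_atLeastLessThan, symmetric])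
    also have "\<dots> = int i * (int b - 1 - int ((b * i) div a))"
      using le by (simp add: of_nat_diff)
    finally show "(\<Sum>j = 1..<b. if b * i \<le> a * j then int i else 0) = int i * (int b - 1 - int ((b * i) div a))" .
  qed simp
  finally show ?thesis .
qed

lemma triangular_sum: "2 * (\<Sum>i = 1..n. int i) = int n * (int n + 1)"
  by (induction n) (auto simp: algebra_simps)

text \<open>Substitute \<open>a j mod b = a j - b ((a j) div b)\<close>. Multiplication by
  \<open>a\<close> permutes the nonzero residues, so the two linear sums agree. The factor 12 clears
  the denominators of the power sums.\<close>

lemma centred_sum_floor:
  fixes a b :: nat
  assumes "b > 0" "coprime a b"
  shows "12 * centred_sum (int a) b =
     8 * int a * ((int b - 1) * int b * (2 * int b - 1)) 
     - 48 * int b * (\<Sum>j = 1..<b. int j * int ((a * j) div b)) - 12 * int b ^2 * (int b - 1)"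
proof -
  let ?r = "\<lambda>j. (a * j) mod b" and ?f = "\<lambda>j. (a * j) div b"
  let ?B = "int b"
  have R: "int (?r j) = int a * int j - ?B * int (?f j)" for j
    by (metis add_diff_cancel_left' mult_div_mod_eq of_nat_add of_nat_mult)
  have m: "(int a * int j) mod ?B = int (?r j)" for j by (simp add: zmod_int)
  have sr: "(\<Sum>j = 1..<b. int (?r j)) = (\<Sum>j = 1..<b. int j)"
    using sum.reindex_bij_betw[OF bij_mult_mod[OF assms], of int] by simp
  have "centred_sum (int a) b = (\<Sum>j = 1..<b. 4 * (int j * int (?r j)) - 2 * ?B * int j - 2 * ?B * int (?r j) + ?B^2)"
    unfolding centred_sum_def m by (intro sum.cong) (auto simp: algebra_simps power2_eq_square)
  also have "\<dots> = 4 * (\<Sum>j = 1..<b. int j * int (?r j)) - 2 * ?B * (\<Sum>j = 1..<b. int j) - 2 * ?B * (\<Sum>j = 1..<b. int j) + (?B - 1) * ?B ^ 2"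
    using assms(1) by (simp add: sum.distrib sum_subtractf sr[unfolded One_nat_def] of_nat_diff flip: sum_distrib_left)
  also have "(\<Sum>j = 1..<b. int j * int (?r j)) = (\<Sum>j = 1..<b. int a * (int j)^2 - ?B * (int j * int (?f j)))"
    unfolding R by (intro sum.cong) (auto simp: algebra_simps power2_eq_square)
  also have "\<dots> = int a * (\<Sum>j = 1..<b. (int j)^2) - ?B * (\<Sum>j = 1..<b. int j * int (?f j))"
    by (simp add: sum_subtractf sum_distrib_left)
  finally show ?thesis
    using sum_nat_squares[OF assms(1)] sum_nat_ids[OF assms(1)] by algebra
qed

text \<open>The residues \<open>a j mod b\<close> permute \<open>1, ..., b - 1\<close>. Equality of
  the sums of squares expresses \<open>U\<close> by the sum \<open>G\<close> of squared floors, and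
  the lattice point count expresses \<open>G\<close> by \<open>V\<close>.\<close>

lemma floor_sum_reciprocity:
  fixes a b :: nat
  assumes "a > 0" "b > 0" "coprime a b"
  defines "U \<equiv> (\<Sum>j = 1..<b. int j * int ((a * j) div b))"
    and "V \<equiv> (\<Sum>i = 1..<a. int i * int ((b * i) div a))"
  shows "12 * int a * U + 12 * int b * V = (int a - 1) * (int b - 1) * (8 * int a * int b - int a - int b - 1)"
proof -
  let ?r = "\<lambda>j. (a * j) mod b" and ?f = "\<lambda>j. (a * j) div b"
  let ?A = "int a" and ?B = "int b"
  define F where "F = (\<Sum>j = 1..<b. int (?f j))"
  define G where "G = (\<Sum>j = 1..<b. (int (?f j))^2)"
  have R: "int (?r j) = int a * int j - ?B * int (?f j)" for j
    by (metis add_diff_cancel_left' mult_div_mod_eq of_nat_add of_nat_mult)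
  \<comment> \<open>Comparing the sums of the residues themselves evaluates \<open>F\<close>, the
    plain sum of the floors.\<close>
  have "(\<Sum>j = 1..<b. int j) = (\<Sum>j = 1..<b. int (?r j))"
    using sum.reindex_bij_betw[OF bij_mult_mod[OF assms(2,3)], of int] by simp
  also have "\<dots> = ?A * (\<Sum>j = 1..<b. int j) - ?B * F"
    unfolding R F_def by (simp add: sum_subtractf sum_distrib_left)
  finally have "?B * (2 * F) = ?B * ((?A - 1) * (?B - 1))"
    using sum_nat_ids[OF assms(2)] by algebra
  then have F: "2 * F = (?A - 1) * (?B - 1)" using assms(2) by simp
  have "(\<Sum>j = 1..<b. (int j)^2) = (\<Sum>j = 1..<b. (int (?r j))^2)"
    using sum.reindex_bij_betw[OF bij_mult_mod[OF assms(2,3)], of "\<lambda>x. (int x)^2"] by simp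
  also have "\<dots> = (\<Sum>j = 1..<b. ?A^2 * (int j)^2 - 2 * ?A * ?B * (int j * int (?f j)) + ?B^2 * (int (?f j))^2)"
    unfolding R by (intro sum.cong) (auto simp: algebra_simps power2_eq_square)
  also have "\<dots> = ?A^2 * (\<Sum>j = 1..<b. (int j)^2) - 2 * ?A * ?B * U + ?B^2 * G"
    by (simp add: sum.distrib sum_subtractf sum_distrib_left U_def G_def)
  finally have "?B * (12 * ?A * U) = ?B * ((?A^2 - 1) * (?B - 1) * (2 * ?B - 1) + 6 * ?B * G)"
    using sum_nat_squares[OF assms(2)] by algebra
  then have U: "12 * ?A * U = (?A^2 - 1) * (?B - 1) * (2 * ?B - 1) + 6 * ?B * G" using assms(2) by simp
  \<comment> \<open>Since \<open>f^2 + f\<close> is twice the \<open>f\<close>-th triangular number,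
    \<open>G + F\<close> is twice the lattice sum.\<close>
  have "G + F = (\<Sum>j = 1..<b. 2 * (\<Sum>i = 1..?f j. int i))"
    unfolding triangular_sum F_def G_def by (simp add: sum.distrib algebra_simps power2_eq_square)
  also have "\<dots> = 2 * (\<Sum>i = 1..<a. int i * (?B - 1 - int ((b * i) div a)))"
    by (simp only: sum_floor_triangular[OF assms(1-3)] flip: sum_distrib_left)
  also have "\<dots> = 2 * ((?B - 1) * (\<Sum>i = 1..<a. int i) - V)"
    by (simp add: V_def algebra_simps sum.distrib sum_subtractf sum_distrib_left)
  finally have "2 * G = 2 * ((?B - 1) * ((?A - 1) * ?A)) - 4 * V - (?A - 1) * (?B - 1)"
    using F sum_nat_ids[OF assms(1)] by algebra
  with U show ?thesis by algebra
qed

text \<open>Weighting the two centred sums by \<open>a^2\<close> and \<open>b^2\<close> makes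
  \<open>U\<close> and \<open>V\<close> enter only through the combination
  \<open>12 a U + 12 b V\<close>, whose value is known.\<close>

theorem ndsum_reciprocity:
  fixes a b :: nat
  assumes "a > 0" "b > 0" "coprime a b"
  shows "ndsum (int a) b + ndsum (int b) a = real a / real b + real b / real a + 1 / (real a * real b) - 3"
proof -
  have ab: "coprime (int a) (int b)" "coprime (int b) (int a)" "coprime b a"
    using assms by (simp_all add: coprime_commute)
  let ?A = "int a" and ?B = "int b"
  define U where "U = (\<Sum>j = 1..<b. int j * int ((a * j) div b))"
  define V where "V = (\<Sum>i = 1..<a. int i * int ((b * i) div a))"
  have "12 * centred_sum ?A b = 8 * ?A * ((?B - 1) * ?B * (2 * ?B - 1)) - 48 * ?B * U - 12 * ?B ^2 * (?B - 1)"
    using centred_sum_floor[OF assms(2,3)] unfolding U_def .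
  moreover have "12 * centred_sum ?B a = 8 * ?B * ((?A - 1) * ?A * (2 * ?A - 1)) - 48 * ?A * V - 12 * ?A ^2 * (?A - 1)"
    using centred_sum_floor[OF assms(1) ab(3)] unfolding V_def .
  moreover have "12 * ?A * U + 12 * ?B * V = (?A - 1) * (?B - 1) * (8 * ?A * ?B - ?A - ?B - 1)"
    unfolding U_def V_def by (rule floor_sum_reciprocity[OF assms])
  ultimately have "12 * (3 * centred_sum ?A b * ?A^2 + 3 * centred_sum ?B a * ?B^2) = 12 * (?A * ?B * (?A^2 + ?B^2 + 1 - 3 * ?A * ?B))"
    by algebra
  then have "3 * centred_sum ?A b * ?A^2 + 3 * centred_sum ?B a * ?B^2 = ?A * ?B * (?A^2 + ?B^2 + 1 - 3 * ?A * ?B)"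
    by simp
  then have "real_of_int (3 * centred_sum ?A b * ?A^2 + 3 * centred_sum ?B a * ?B^2) = of_int (?A * ?B * (?A^2 + ?B^2 + 1 - 3 * ?A * ?B))"
    by (simp only:)
  then have "real_of_int (3 * centred_sum ?A b) * real a ^2 + of_int (3 * centred_sum ?B a) * real b^2 = real a * real b * (real a^2 + real b^2 + 1 - 3 * real a * real b)"
    by simp
  then have "(real b ^ 2 * ndsum (int a) b) * real a ^ 2 + (real a ^ 2 * ndsum (int b) a) * real b ^ 2 =
     real a * real b * (real a^2 + real b^2 + 1 - 3 * real a * real b)"
    using ndsum_centred[OF assms(2) ab(1)] ndsum_centred[OF assms(1) ab(2)] by simp
  then have "(real a * real b) * (real a * real b * (ndsum (int a) b + ndsum (int b) a)) = (real a * real b) * (real a^2 + real b^2 + 1 - 3 * real a * real b)"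
    by (simp add: algebra_simps power2_eq_square)
  then have "real a * real b * (ndsum (int a) b + ndsum (int b) a) = real a^2 + real b^2 + 1 - 3 * real a * real b"
    using assms by simp
  then show ?thesis using assms by (simp add: field_simps power2_eq_square)
qed

section \<open>Rademacher's function\<close>

text \<open>The arguments are the entries of the matrix (a, b; c, d). On the modular group
  \<open>c = 0\<close> forces \<open>d\<close> to be 1 or -1, so \<open>b * d\<close> is the usual
  value \<open>b / d\<close>.\<close>

definition rademacher :: "int \<Rightarrow> int \<Rightarrow> int \<Rightarrow> int \<Rightarrow> real" where
  "rademacher a b c d =
    (if c = 0 then of_int (b * d) else of_int (a + d) / of_int c - of_int (sgn c) * ndsum d (nat \<bar>c\<bar>))"

lemma ndsum_1 [simp]: "ndsum a 1 = 0" "ndsum a (Suc 0) = 0"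
  by (simp_all add: normalized_dedekind_sum_def dedekind_sum_def sawtooth_def)

text \<open>Both sides change sign whenever \<open>c\<close> or \<open>d\<close> does, which reduces
  the claim to positive arguments.\<close>

lemma ndsum_reciprocity_int:
  assumes "c \<noteq> 0" "d \<noteq> 0" "coprime c d"
  shows "of_int (sgn d) * ndsum c (nat \<bar>d\<bar>) + of_int (sgn c) * ndsum d (nat \<bar>c\<bar>) =
    of_int c / of_int d + of_int d / of_int c + 1 / of_int (c * d) - 3 * of_int (sgn (c * d))"
proof -
  let ?c = "nat \<bar>c\<bar>" and ?d = "nat \<bar>d\<bar>"
  have "coprime (int ?c) (int ?d)" using assms(3) by simp
  then have cop: "coprime ?c ?d" by (simp only: coprime_int_iff)
  have pos: "?c > 0" "?d > 0" using assms by auto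
  have flip: "ndsum x (nat \<bar>y\<bar>) = of_int (sgn x) * ndsum (int (nat \<bar>x\<bar>)) (nat \<bar>y\<bar>)" if "y \<noteq> 0" "x \<noteq> 0" for x y :: int
    using that ndsum_minus[of "nat \<bar>y\<bar>" x] by (cases "x > 0") (auto simp: abs_if)
  have R: "ndsum (int ?c) ?d + ndsum (int ?d) ?c = real ?c / real ?d + real ?d / real ?c + 1 / (real ?c * real ?d) - 3"
    by (rule ndsum_reciprocity[OF pos cop])
  have "of_int (sgn d) * ndsum c ?d + of_int (sgn c) * ndsum d ?c =
    of_int (sgn c * sgn d) * (ndsum (int ?c) ?d + ndsum (int ?d) ?c)"
    using flip[OF assms(2,1)] flip[OF assms(1,2)] by (simp add: algebra_simps)
  also have "\<dots> = of_int c / of_int d + of_int d / of_int c + 1 / of_int (c * d) - 3 * of_int (sgn (c * d))"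
    unfolding R sgn_mult using assms(1,2)
    by (cases "c > 0"; cases "d > 0") (simp_all add: field_simps not_less)
  finally show ?thesis .
qed

text \<open>Right multiplication by S = (0, -1; 1, 0). For \<open>c\<close> and \<open>d\<close>
  both nonzero this is reciprocity, since the determinant gives
  \<open>b/d - a/c = - 1/(c d)\<close>.\<close>

lemma rademacher_S:
  assumes "a * d - b * c = 1"
  shows "rademacher b (- a) d (- c) = rademacher a b c d - 3 * of_int (sgn (c * d))"
proof -
  consider "c = 0" | "d = 0" | "c \<noteq> 0" "d \<noteq> 0" by blast
  then show ?thesis
  proof cases
    case 1
    then have "a * d = 1" using assms by simp
    then have "d = 1 \<or> d = -1" using zmult_eq_1_iff by blast
    then show ?thesis using 1 by (auto simp: rademacher_def)
  next
    case 2
    then have "b * c = -1" using assms by simp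
    then have "c = 1 \<or> c = -1" using zmult_eq_neg1_iff by blast
    then show ?thesis using 2 \<open>b * c = -1\<close> by (auto simp: rademacher_def)
  next
    case 3
    have "coprime c d"
    proof (rule coprimeI)
      fix e assume "e dvd c" "e dvd d"
      then have "e dvd a * d - b * c" by simp
      then show "is_unit e" by (simp add: assms)
    qed
    note R = ndsum_reciprocity_int[OF 3 this]
    have m: "ndsum (- c) (nat \<bar>d\<bar>) = - ndsum c (nat \<bar>d\<bar>)" using 3 by (intro ndsum_minus) auto
    have "real_of_int (a * d - b * c) = 1" using assms by simp
    then have "of_int b / of_int d - of_int a / of_int c + 1 / (of_int c * of_int d) = (0::real)"
      using 3 by (simp add: field_simps)
    with R m 3 show ?thesis by (simp add: rademacher_def add_divide_distrib diff_divide_distrib)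
  qed
qed

text \<open>Right multiplication by (1, n; 0, 1): the Dedekind sum is periodic in \<open>d\<close>
  and only the trace term moves.\<close>

lemma rademacher_T:
  assumes "a * d - b * c = 1"
  shows "rademacher a (b + n * a) c (d + n * c) = rademacher a b c d + of_int n"
proof (cases "c = 0")
  case True
  then have "a * d = 1" using assms by simp
  then have "real_of_int a * real_of_int d = 1" by (metis of_int_1 of_int_mult)
  then show ?thesis using True by (simp add: rademacher_def algebra_simps)
next
  case False
  have "ndsum (d + n * c) (nat \<bar>c\<bar>) = ndsum d (nat \<bar>c\<bar>)"
    by (rule ndsum_cong) (use False in \<open>auto simp: cong_iff_dvd_diff\<close>)
  then show ?thesis using False by (simp add: rademacher_def field_simps)
qed

lemma rademacher_minus: "rademacher (- a) (- b) (- c) (- d) = rademacher a b c d"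
proof (cases "c = 0")
  case False
  then have "ndsum (- d) (nat \<bar>c\<bar>) = - ndsum d (nat \<bar>c\<bar>)" by (intro ndsum_minus) simp
  then show ?thesis using False by (simp add: rademacher_def sgn_minus field_simps)
qed (simp add: rademacher_def)

section \<open>The composition law on the modular group\<close>

text \<open>Compatibility of the sign term with S: \<open>(c, d)\<close> is the bottom row of N,
  \<open>(u, v)\<close> that of M N, and \<open>C\<close> the lower left entry of M. If all four are
  nonzero, the terms cancel in pairs. When \<open>u d\<close> and \<open>v c\<close> have equal
  signs, \<open>u v\<close> pairs with \<open>c d\<close>. Otherwise \<open>C\<close> has the sign
  of \<open>u d\<close>, and each term containing \<open>C\<close> pairs with the one on the other
  side that does not.\<close>

lemma sgn_cocycle_step:
  fixes c d u v C :: int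
  assumes C: "C = u * d - v * c" and uv: "u \<noteq> 0 \<or> v \<noteq> 0" and cd: "c \<noteq> 0 \<or> d \<noteq> 0"
  shows "sgn (C * c * u) + sgn (u * v) = sgn (c * d) + sgn (C * d * v)"
proof -
  have sq: "sgn x * sgn x = 1" if "x \<noteq> 0" for x :: int using that by (simp add: sgn_if)
  have goal: ?thesis if "sgn C * sgn c * sgn u + sgn u * sgn v = sgn c * sgn d + sgn C * sgn d * sgn v"
    using that by (simp only: sgn_mult)
  consider "c = 0" | "d = 0" | "u = 0" | "v = 0" | "c \<noteq> 0" "d \<noteq> 0" "u \<noteq> 0" "v \<noteq> 0" by blast
  then show ?thesis
  proof cases
    case 1
    then have "sgn C = sgn u * sgn d" "sgn c = 0" using C by (simp_all add: sgn_mult)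
    with sq[of d] 1 cd show ?thesis by (intro goal) auto
  next
    case 2
    then have "sgn C = - (sgn v * sgn c)" "sgn d = 0" using C by (simp_all add: sgn_mult sgn_minus)
    with sq[of c] 2 cd show ?thesis by (intro goal) auto
  next
    case 3
    then have "sgn C = - (sgn v * sgn c)" "sgn u = 0" using C by (simp_all add: sgn_mult sgn_minus)
    with sq[of v] 3 uv show ?thesis by (intro goal) auto
  next
    case 4
    then have "sgn C = sgn u * sgn d" "sgn v = 0" using C by (simp_all add: sgn_mult)
    with sq[of u] 4 uv show ?thesis by (intro goal) auto
  next
    case 5
    note sqs = sq[OF 5(1)] sq[OF 5(2)] sq[OF 5(3)] sq[OF 5(4)]
    show ?thesis
    proof (cases "sgn (u * d) = sgn (v * c)")
      case True
      then have "sgn u * sgn d = sgn v * sgn c" by (simp only: sgn_mult)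
      with sqs have "sgn u * sgn v = sgn c * sgn d" "sgn c * sgn u = sgn d * sgn v" by algebra+
      then show ?thesis by (intro goal) (simp add: mult.assoc)
    next
      case False
      have nz: "u * d \<noteq> 0" "v * c \<noteq> 0" using 5 by simp_all
      have "sgn C = sgn (u * d) \<and> sgn (v * c) = - sgn (u * d)"
        using C False nz unfolding sgn_if by presburger
      then have "sgn C = sgn u * sgn d" "sgn v * sgn c = - (sgn u * sgn d)" by (simp_all only: sgn_mult)
      with sqs have "sgn C * sgn c * sgn u = sgn c * sgn d" "sgn C * sgn d * sgn v = sgn u * sgn v"
        by algebra+
      then show ?thesis by (intro goal) linarith
    qed
  qed
qed

text \<open>Rademacher's composition law for every left factor; the class of right factors satisfying it is closed under
  multiplication by the generators of the modular group.\<close>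

definition composes :: "int \<Rightarrow> int \<Rightarrow> int \<Rightarrow> int \<Rightarrow> bool" where
  "composes a b c d \<longleftrightarrow> (\<forall>A B C D. A * D - B * C = 1 \<longrightarrow>
     rademacher (A * a + B * c) (A * b + B * d) (C * a + D * c) (C * b + D * d) =
     rademacher A B C D + rademacher a b c d - 3 * of_int (sgn (C * c * (C * a + D * c))))"

lemma det_mult:
  fixes A :: int
  assumes "A * D - B * C = 1" "a * d - b * c = 1"
  shows "(A * a + B * c) * (C * b + D * d) - (A * b + B * d) * (C * a + D * c) = 1"
  using assms by algebra

lemma composes_S:
  assumes "a * d - b * c = 1" "composes a b c d"
  shows "composes b (- a) d (- c)"
  unfolding composes_def
proof (intro allI impI)
  fix A B C D :: int assume M: "A * D - B * C = 1"
  let ?u = "C * a + D * c" and ?v = "C * b + D * d"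
  \<comment> \<open>The lower left entry of M is read off from (M N) times the inverse of N.\<close>
  have "C = ?u * d - ?v * c" using assms(1) by algebra
  moreover have "?u \<noteq> 0 \<or> ?v \<noteq> 0" using det_mult[OF M assms(1)] by auto
  moreover have "c \<noteq> 0 \<or> d \<noteq> 0" using assms(1) by auto
  ultimately have "sgn (C * c * ?u) + sgn (?u * ?v) = sgn (c * d) + sgn (C * d * ?v)"
    by (rule sgn_cocycle_step)
  then have s: "real_of_int (sgn (C * c * ?u)) + of_int (sgn (?u * ?v)) = of_int (sgn (c * d)) + of_int (sgn (C * d * ?v))"
    by (metis of_int_add)
  have "rademacher (A * b + B * d) (- (A * a + B * c)) ?v (- ?u) =
    rademacher (A * a + B * c) (A * b + B * d) ?u ?v - 3 * of_int (sgn (?u * ?v))"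
    by (rule rademacher_S) (rule det_mult[OF M assms(1)])
  also have "\<dots> = rademacher A B C D + rademacher b (- a) d (- c) - 3 * of_int (sgn (C * d * ?v))"
    using assms(2) M s rademacher_S[OF assms(1)] unfolding composes_def by auto
  finally show "rademacher (A * b + B * d) (A * - a + B * - c) (C * b + D * d) (C * - a + D * - c) =
       rademacher A B C D + rademacher b (- a) d (- c) - 3 * of_int (sgn (C * d * (C * b + D * d)))"
    by simp
qed

lemma composes_T:
  assumes "a * d - b * c = 1" "composes a b c d"
  shows "composes a (b + n * a) c (d + n * c)"
  unfolding composes_def
proof (intro allI impI)
  fix A B C D :: int assume M: "A * D - B * C = 1"
  have "A * (b + n * a) + B * (d + n * c) = (A * b + B * d) + n * (A * a + B * c)"
       "C * (b + n * a) + D * (d + n * c) = (C * b + D * d) + n * (C * a + D * c)" by algebra+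
  then show "rademacher (A * a + B * c) (A * (b + n * a) + B * (d + n * c)) (C * a + D * c) (C * (b + n * a) + D * (d + n * c)) =
       rademacher A B C D + rademacher a (b + n * a) c (d + n * c) - 3 * of_int (sgn (C * c * (C * a + D * c)))"
    using rademacher_T[OF det_mult[OF M assms(1)], of n] rademacher_T[OF assms(1), of n] assms(2) M
    unfolding composes_def by simp
qed

lemma composes_minus:
  assumes "composes a b c d"
  shows "composes (- a) (- b) (- c) (- d)"
  unfolding composes_def
proof (intro allI impI)
  fix A B C D :: int assume M: "A * D - B * C = 1"
  have e: "x * - y + z * - w = - (x * y + z * w)" for x y z w :: int by simp
  have "C * - c * - (C * a + D * c) = C * c * (C * a + D * c)" by algebra
  then show "rademacher (A * - a + B * - c) (A * - b + B * - d) (C * - a + D * - c) (C * - b + D * - d) =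
       rademacher A B C D + rademacher (- a) (- b) (- c) (- d) - 3 * of_int (sgn (C * - c * (C * - a + D * - c)))"
    unfolding e rademacher_minus using assms M by (simp add: composes_def)
qed

lemma composes_one: "composes 1 0 0 1"
proof -
  have "rademacher 1 0 0 1 = 0" by (simp add: rademacher_def)
  then show ?thesis by (simp add: composes_def)
qed

text \<open>Euclid's algorithm on the bottom row: a power of T replaces \<open>d\<close> by
  \<open>d mod c\<close>, and S then moves this smaller number into the place of
  \<open>c\<close>.\<close>

lemma composes_SL2:
  assumes "a * d - b * c = 1"
  shows "composes a b c d"
  using assms
proof (induction "nat \<bar>c\<bar>" arbitrary: a b c d rule: less_induct)
  case less
  show ?case
  proof (cases "c = 0")
    case True
    then have "a * d = 1" using less.prems by simp
    then consider "a = 1" "d = 1" | "a = -1" "d = -1" using zmult_eq_1_iff by blast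
    then show ?thesis
    proof cases
      case 1
      have "composes 1 (0 + b * 1) 0 (1 + b * 0)"
        by (rule composes_T[OF _ composes_one]) simp
      then show ?thesis unfolding True 1 by simp
    next
      case 2
      have "composes 1 (0 + (- b) * 1) 0 (1 + (- b) * 0)"
        by (rule composes_T[OF _ composes_one]) simp
      from composes_minus[OF this] show ?thesis unfolding True 2 by simp
    qed
  next
    case False
    define n where "n = - (d div c)"
    let ?b = "b + n * a" and ?d = "d + n * c"
    have d: "?d = d mod c" by (simp add: n_def minus_div_mult_eq_mod)
    have "\<bar>?d\<bar> < \<bar>c\<bar>" using False unfolding d by (rule abs_mod_less)
    then have lt: "nat \<bar>?d\<bar> < nat \<bar>c\<bar>" using False by simp
    have det: "?b * (- c) - (- a) * ?d = 1" using less.prems by algebra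
    have "composes ?b (- a) ?d (- c)" by (rule less.hyps[OF lt det])
    \<comment> \<open>The induction hypothesis concerns N T^n S. A second S yields - N T^n, after
      which the sign and then T^n are removed.\<close>
    from composes_S[OF det this] have "composes (- a) (- ?b) (- c) (- ?d)" .
    from composes_minus[OF this] have 1: "composes a ?b c ?d" by (simp only: minus_minus)
    have "a * ?d - ?b * c = 1" using less.prems by algebra
    from composes_T[OF this 1, of "- n"] show ?thesis by simp
  qed
qed

theorem rademacher_mult:
  assumes "A * D - B * C = 1" "a * d - b * c = 1"
  shows "rademacher (A * a + B * c) (A * b + B * d) (C * a + D * c) (C * b + D * d) =
     rademacher A B C D + rademacher a b c d - 3 * of_int (sgn (C * c * (C * a + D * c)))"
  using composes_SL2[OF assms(2)] assms(1) by (simp add: composes_def)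

text \<open>The product with the inverse is the identity, whose lower left entry \<open>0\<close>
  kills the sign term.\<close>

lemma rademacher_inverse:
  assumes "a * d - b * c = 1"
  shows "rademacher d (- b) (- c) a = - rademacher a b c d"
proof -
  have e: "d * a + - b * c = 1" "d * b + - b * d = 0" "- c * a + a * c = 0" "- c * b + a * d = 1"
    using assms by (auto simp: mult.commute)
  have "d * a - (-b) * (-c) = 1" using e(1) by simp
  from rademacher_mult[OF this assms]
  have "rademacher 1 0 0 1 = rademacher d (- b) (- c) a + rademacher a b c d - 3 * of_int (sgn (- c * c * 0))"
    unfolding e .
  then show ?thesis by (simp add: rademacher_def)
qed

section \<open>Shifting a value\<close>

text \<open>The same Euclidean descent as for the composition law: T and S change the Rademacher
  number by integers, and it is an integer at \<open>c = 0\<close>.\<close>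

lemma rademacher_int:
  assumes "a * d - b * c = 1"
  shows "rademacher a b c d \<in> \<int>"
  using assms
proof (induction "nat \<bar>c\<bar>" arbitrary: a b c d rule: less_induct)
  case less
  show ?case
  proof (cases "c = 0")
    case True
    then show ?thesis by (simp add: rademacher_def)
  next
    case False
    define n where "n = - (d div c)"
    let ?b = "b + n * a" and ?d = "d + n * c"
    have d: "?d = d mod c" by (simp add: n_def minus_div_mult_eq_mod)
    have "\<bar>?d\<bar> < \<bar>c\<bar>" using False unfolding d by (rule abs_mod_less)
    then have lt: "nat \<bar>?d\<bar> < nat \<bar>c\<bar>" using False by simp
    have det: "?b * (- c) - (- a) * ?d = 1" using less.prems by algebra
    have 1: "rademacher ?b (- a) ?d (- c) \<in> \<int>" by (rule less.hyps[OF lt det])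
    have det': "a * ?d - ?b * c = 1" using less.prems by algebra
    have "rademacher a b c d = rademacher ?b (- a) ?d (- c) + of_int (3 * sgn (c * ?d) - n)"
      using rademacher_S[OF det'] rademacher_T[OF less.prems, of n] by simp
    then show ?thesis using 1 by simp
  qed
qed

section \<open>Values and the matrices that represent them\<close>

definition is_value :: "int \<Rightarrow> int \<Rightarrow> bool" where
  "is_value q k \<longleftrightarrow> is_normalized_dedekind_value (of_int k / of_int q)"

text \<open>Lower left entry \<open>q g\<close> and trace \<open>g k\<close> make the trace quotient
  equal to \<open>k/q\<close>, so the difference is the Dedekind sum
  \<open>S(d, q g)\<close>.\<close>

lemma valueI:
  assumes "q > 0" "g > 0" "a * d - x * (q * g) = 1" "a + d = g * k"
  shows "is_normalized_dedekind_value (of_int k / of_int q - rademacher a x (q * g) d)"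
proof -
  have pos: "q * g > 0" using assms by simp
  have "of_int (a + d) / of_int (q * g) = (of_int k / of_int q :: real)"
    unfolding assms(4) using assms by simp
  then have "of_int k / of_int q - rademacher a x (q * g) d = ndsum d (nat (q * g))"
    using pos assms(1,2) by (simp add: rademacher_def)
  moreover have "coprime d (q * g)"
  proof (rule coprimeI)
    fix e assume "e dvd d" "e dvd q * g"
    then have "e dvd a * d - x * (q * g)" by simp
    then show "is_unit e" by (simp only: assms(3))
  qed
  then have "coprime d (int (nat (q * g)))" using pos by simp
  moreover have "nat (q * g) \<ge> 1" using pos by linarith
  ultimately show ?thesis unfolding is_normalized_dedekind_value_def by blast
qed

text \<open>A matrix with bottom row \<open>(b, d)\<close> has an integral Rademacher number, which
  can be normalised to \<open>0\<close>. Then the trace divided by \<open>b\<close> is exactly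
  \<open>k/q\<close>, and lowest terms force \<open>q\<close> to divide \<open>b\<close>.\<close>

lemma ndsum_valueE:
  assumes "q > 0" "coprime k q" "b > 0" "coprime d (int b)" "ndsum d b = of_int k / of_int q"
  obtains a x g where "g > 0" "int b = q * g" "a * d - x * (q * g) = 1" "a + d = g * k"
    "rademacher a x (q * g) d = 0"
proof -
  obtain u v where "u * d + v * int b = 1"
    using bezout_int[of d "int b"] assms(4) by (metis coprime_iff_gcd_eq_1)
  then have uv: "u * d - (- v) * int b = 1" by simp
  then obtain t where t: "rademacher u (- v) (int b) d = of_int t"
    using rademacher_int by (metis Ints_cases)
  \<comment> \<open>Subtracting \<open>t\<close> times the bottom row from the top row lowers the
    Rademacher number by \<open>t\<close>.\<close>
  define a where "a = u - t * int b"
  define x where "x = - v - t * d"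
  have det: "a * d - x * int b = 1" using uv unfolding a_def x_def by (simp add: algebra_simps)
  have sgn: "sgn (int b) = 1" using assms(3) by simp
  from t have "of_int (u + d) / real b - of_int k / of_int q = of_int t"
    using assms(3,5) sgn by (simp add: rademacher_def)
  then have *: "of_int (a + d) / real b = of_int k / of_int q"
    using assms(3) by (simp add: a_def field_simps)
  then have "real_of_int ((a + d) * q) = of_int (k * int b)"
    using assms(1,3) by (simp add: field_simps)
  then have e: "(a + d) * q = k * int b" by (simp only: of_int_eq_iff)
  then have "q dvd k * int b" by (metis dvd_triv_right)
  then have "q dvd int b" using assms(2) by (simp add: coprime_commute coprime_dvd_mult_right_iff)
  then obtain g where g: "int b = q * g" by blast
  have "g > 0" using assms(1,3) g by (metis of_nat_0_less_iff zero_less_mult_pos)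
  moreover have "a + d = g * k" using e assms(1) unfolding g by simp
  moreover have "rademacher a x (q * g) d = 0"
    using * assms(3,5) sgn unfolding g[symmetric] by (simp add: rademacher_def)
  ultimately show ?thesis using that g det by metis
qed

text \<open>The matrix \<open>M = (a, x; q g, d)\<close> of a value \<open>k/q\<close> has Rademacher number \<open>0\<close>. The product \<open>P M Q\<^sup>-\<^sup>1\<close> with
  \<open>P = (p, y; q r, s)\<close> and \<open>Q = (p - k r, z; q r, s + k r)\<close> again has lower left entry \<open>q g'\<close> and trace
  \<open>g' k\<close>, and the two sign terms of the composition law cancel.\<close>

lemma value_conjugate:
  assumes q: "q > 0" and k: "coprime k q" and r: "r \<noteq> 0" and val: "is_value q k"
    and P: "p * s - y * (q * r) = 1" and Q: "(p - k * r) * (s + k * r) - z * (q * r) = 1"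
  shows "is_normalized_dedekind_value (of_int k / of_int q - rademacher p y (q * r) s
    + rademacher (p - k * r) z (q * r) (s + k * r))"
proof -
  from val obtain d b where "b \<ge> 1" "coprime d (int b)" "ndsum d b = of_int k / of_int q"
    unfolding is_value_def is_normalized_dedekind_value_def by metis
  then obtain a x g where g: "g > 0" and M: "a * d - x * (q * g) = 1" and tr: "a + d = g * k"
    and M0: "rademacher a x (q * g) d = 0"
    using ndsum_valueE[OF q k, of b d] by (metis less_eq_Suc_le One_nat_def)
  \<comment> \<open>\<open>h\<close> is the cofactor of \<open>g\<close> in \<open>a^2 + 1\<close>.
    It makes \<open>g g'\<close> the sum of squares \<open>(g s + a r)^2 + r^2\<close>, whence
    \<open>g'\<close> is positive.\<close>
  define h where "h = a * k - x * q"
  define g' where "g' = g * s^2 + 2 * a * r * s + h * r^2"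
  have "g * h = a * (a + d) - x * (q * g)" unfolding tr h_def by (simp add: algebra_simps)
  also have "\<dots> = a^2 + 1" using M by (simp add: algebra_simps power2_eq_square)
  finally have "g * g' = (g * s + a * r)^2 + r^2" unfolding g'_def by algebra
  moreover have "(g * s + a * r)^2 + r^2 > 0" using r by (simp add: add_nonneg_pos)
  ultimately have g': "g' > 0" using g by (metis zero_less_mult_pos)
  have d: "d = g * k - a" using tr by simp
  let ?a = "p * a + y * (q * g)" and ?b = "p * x + y * d"
    and ?c = "q * r * a + s * (q * g)" and ?d = "q * r * x + s * d"
  let ?s = "s + k * r" and ?p = "p - k * r"
  have Q': "?s * ?p - (- z) * (- (q * r)) = 1" using Q by (simp add: algebra_simps)
  have detPM: "?a * ?d - ?b * ?c = 1" by (rule det_mult[OF P M])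
  have c': "?c * ?s + ?d * (- (q * r)) = q * g'"
    unfolding g'_def h_def d by algebra
  \<comment> \<open>The determinants of P and Q determine only the products \<open>y (q r)\<close>
    and \<open>z (q r)\<close>; the extra factor \<open>r\<close> allows \<open>y\<close> and
    \<open>z\<close> to be eliminated through them.\<close>
  have "r * ((?a * ?s + ?b * (- (q * r))) + (?c * (- z) + ?d * ?p)) = r * (g' * k)"
    using P Q unfolding g'_def h_def d by algebra
  then have tr': "(?a * ?s + ?b * (- (q * r))) + (?c * (- z) + ?d * ?p) = g' * k"
    using r by simp
  have "rademacher ?a ?b ?c ?d = rademacher p y (q * r) s - 3 * of_int (sgn (q * r * (q * g) * ?c))"
    using rademacher_mult[OF P M] M0 by simp
  moreover have "rademacher (?a * ?s + ?b * (- (q * r))) (?a * (- z) + ?b * ?p) (q * g') (?c * (- z) + ?d * ?p) =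
    rademacher ?a ?b ?c ?d + rademacher ?s (- z) (- (q * r)) ?p - 3 * of_int (sgn (?c * (- (q * r)) * (q * g')))"
    using rademacher_mult[OF detPM Q'] unfolding c' .
  moreover have "sgn (?c * (- (q * r)) * (q * g')) = - sgn (q * r * (q * g) * ?c)"
    using q g g' by (simp add: sgn_mult sgn_minus)
  moreover have "rademacher ?s (- z) (- (q * r)) ?p = - rademacher ?p z (q * r) ?s"
    by (rule rademacher_inverse[OF Q])
  ultimately have R: "rademacher (?a * ?s + ?b * (- (q * r))) (?a * (- z) + ?b * ?p) (q * g') (?c * (- z) + ?d * ?p) =
    rademacher p y (q * r) s - rademacher ?p z (q * r) ?s" by simp
  have "(?a * ?s + ?b * (- (q * r))) * (?c * (- z) + ?d * ?p) - (?a * (- z) + ?b * ?p) * (q * g') = 1"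
    using det_mult[OF detPM Q'] unfolding c' .
  from valueI[OF q g' this tr'] show ?thesis unfolding R by (simp add: algebra_simps)
qed

text \<open>A shift moves the value by the integer \<open>\<delta>\<close> and keeps the class of
  the numerator modulo \<open>q\<close>, so it can be iterated. The implication goes one way;
  reversibility is recorded by having \<open>- \<delta>\<close> as well.\<close>

definition is_shift :: "int \<Rightarrow> int \<Rightarrow> int \<Rightarrow> bool" where
  "is_shift q k\<^sub>0 \<delta> \<longleftrightarrow> (\<forall>k. [k = k\<^sub>0] (mod q) \<longrightarrow> is_value q k \<longrightarrow> is_value q (k + q * \<delta>))"

text \<open>With \<open>p\<close> inverse to \<open>s\<close> modulo \<open>q r\<close>, the
  congruence for \<open>s (s + k r)\<close> is what allows Q to be completed to a matrix of
  determinant 1. Conjugation with P and Q gives one direction, and their inverses, where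
  \<open>r\<close> becomes \<open>- r\<close>, give the other.\<close>

lemma is_shift_both:
  assumes q: "q > 0" and k0: "coprime k\<^sub>0 q" and r: "r > 0" and s: "coprime s (q * r)"
    and c: "[s * (s + k\<^sub>0 * r) = 1] (mod q)"
    and \<delta>: "ndsum s (nat (q * r)) - ndsum (s + k\<^sub>0 * r) (nat (q * r)) = of_int \<delta>"
  shows "is_shift q k\<^sub>0 \<delta> \<and> is_shift q k\<^sub>0 (- \<delta>)"
proof -
  have "is_value q (k + q * \<delta>) \<and> is_value q (k + q * (- \<delta>))" if k: "[k = k\<^sub>0] (mod q)" and v: "is_value q k" for k
  proof -
    have kq: "coprime k q" using k k0 by (metis cong_imp_coprime cong_sym)
    have pos: "q * r > 0" using q r by simp
    obtain p y where "s * p + q * r * y = 1"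
      using bezout_int[of s "q * r"] s by (metis coprime_iff_gcd_eq_1 mult.commute)
    then have P: "p * s - (- y) * (q * r) = 1" by (simp add: algebra_simps)
    have "[s * (s + k * r) = s * (s + k\<^sub>0 * r)] (mod q)"
      by (intro cong_mult cong_add cong_refl k)
    then have "q dvd s * (s + k * r) - 1" using c by (metis cong_trans cong_iff_dvd_diff)
    moreover have "s * (s + k * r) - 1 = s * (s + k * r - p) + q * (- y * r)"
      using P by (simp add: algebra_simps)
    ultimately have "q dvd s * (s + k * r - p)" by (metis dvd_add_times_triv_right_iff mult.commute)
    then have "q dvd s + k * r - p" using s by (simp add: coprime_commute coprime_dvd_mult_right_iff)
    then obtain w where w: "s + k * r - p = q * w" by blast
    have "(p - k * r) * (s + k * r) = p * s - k * r * (s + k * r - p)" by (simp add: algebra_simps)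
    also have "\<dots> = 1 + (- y - k * w) * (q * r)" unfolding w using P by (simp add: algebra_simps)
    finally have Q: "(p - k * r) * (s + k * r) - (- y - k * w) * (q * r) = 1" by simp
    let ?z = "- y - k * w"
    \<comment> \<open>The factor \<open>r\<close> lifts the congruence of \<open>k\<close> from
      modulus \<open>q\<close> to \<open>q r\<close>, so the shift is the same for the whole
      class.\<close>
    have "[s + k * r = s + k\<^sub>0 * r] (mod q * r)"
      using k by (simp add: cong_iff_dvd_diff flip: left_diff_distrib)
    then have e: "ndsum (s + k * r) (nat (q * r)) = ndsum (s + k\<^sub>0 * r) (nat (q * r))"
      using pos by (intro ndsum_cong) simp_all
    have sg: "sgn (q * r) = 1" using pos by simp
    \<comment> \<open>P and Q have the same trace and the same lower left entry, so only the two
      Dedekind sums survive in the difference.\<close>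
    have D: "rademacher p (- y) (q * r) s - rademacher (p - k * r) ?z (q * r) (s + k * r) = - of_int \<delta>"
      using q r \<delta> sg e by (simp add: rademacher_def)
    have "is_normalized_dedekind_value (of_int k / of_int q - rademacher p (- y) (q * r) s
       + rademacher (p - k * r) ?z (q * r) (s + k * r))"
      using r by (intro value_conjugate[OF q kq _ v P Q]) simp
    moreover have "of_int k / of_int q - rademacher p (- y) (q * r) s
       + rademacher (p - k * r) ?z (q * r) (s + k * r) = of_int (k + q * \<delta>) / of_int q"
      using D q by (simp add: add_divide_distrib)
    ultimately have 1: "is_value q (k + q * \<delta>)" by (simp add: is_value_def)
    \<comment> \<open>The inverses of P and Q satisfy the same requirements with \<open>r\<close>
      negated and \<open>p\<close>, \<open>s\<close> interchanged.\<close>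
    have P': "s * p - y * (q * (- r)) = 1" using P by (simp add: algebra_simps)
    have Q': "(s - k * (- r)) * (p + k * (- r)) - (- ?z) * (q * (- r)) = 1" using Q by (simp add: algebra_simps)
    have "is_normalized_dedekind_value (of_int k / of_int q - rademacher s y (q * (- r)) p
       + rademacher (s - k * (- r)) (- ?z) (q * (- r)) (p + k * (- r)))"
      using r by (intro value_conjugate[OF q kq _ v P' Q']) simp
    moreover have "rademacher s y (q * (- r)) p = - rademacher p (- y) (q * r) s"
      using rademacher_inverse[OF P] by simp
    moreover have "rademacher (s - k * (- r)) (- ?z) (q * (- r)) (p + k * (- r)) = - rademacher (p - k * r) ?z (q * r) (s + k * r)"
      using rademacher_inverse[OF Q] by simp
    moreover have "of_int k / of_int q - - rademacher p (- y) (q * r) s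
       + - rademacher (p - k * r) ?z (q * r) (s + k * r) = of_int (k + q * (- \<delta>)) / of_int q"
      using D q by (simp add: diff_divide_distrib)
    ultimately have 2: "is_value q (k + q * (- \<delta>))" by (simp add: is_value_def)
    show ?thesis using 1 2 by blast
  qed
  then show ?thesis unfolding is_shift_def by blast
qed

lemma is_shift_add:
  assumes "is_shift q k\<^sub>0 \<delta>" "is_shift q k\<^sub>0 \<epsilon>"
  shows "is_shift q k\<^sub>0 (\<delta> + \<epsilon>)"
  unfolding is_shift_def
proof (intro allI impI)
  fix k assume k: "[k = k\<^sub>0] (mod q)" "is_value q k"
  then have "is_value q (k + q * \<delta>)" using assms(1) by (simp add: is_shift_def)
  moreover have "[k + q * \<delta> = k\<^sub>0] (mod q)" using k(1) by (simp add: cong_def)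
  ultimately have "is_value q (k + q * \<delta> + q * \<epsilon>)" using assms(2) by (simp add: is_shift_def)
  then show "is_value q (k + q * (\<delta> + \<epsilon>))" by (simp add: algebra_simps)
qed

lemma is_shift_nat_mult: "is_shift q k\<^sub>0 \<delta> \<Longrightarrow> is_shift q k\<^sub>0 (int n * \<delta>)"
proof (induction n)
  case 0
  then show ?case by (simp add: is_shift_def)
next
  case (Suc n)
  then show ?case using is_shift_add[of q k\<^sub>0 \<delta> "int n * \<delta>"] by (simp add: algebra_simps)
qed

lemma is_shift_int_mult:
  assumes "is_shift q k\<^sub>0 \<delta> \<and> is_shift q k\<^sub>0 (- \<delta>)"
  shows "is_shift q k\<^sub>0 (n * \<delta>)"
proof (cases "n \<ge> 0")
  case True
  then show ?thesis using is_shift_nat_mult[of q k\<^sub>0 \<delta> "nat n"] assms by simp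
next
  case False
  then show ?thesis using is_shift_nat_mult[of q k\<^sub>0 "- \<delta>" "nat (- n)"] assms by simp
qed

text \<open>Bezout's identity: two reversible shifts generate all their integer
  combinations.\<close>

lemma is_shift_gcd:
  assumes "is_shift q k\<^sub>0 \<delta> \<and> is_shift q k\<^sub>0 (- \<delta>)" "is_shift q k\<^sub>0 \<epsilon> \<and> is_shift q k\<^sub>0 (- \<epsilon>)"
  shows "is_shift q k\<^sub>0 (gcd \<delta> \<epsilon>) \<and> is_shift q k\<^sub>0 (- gcd \<delta> \<epsilon>)"
proof -
  obtain u v where uv: "u * \<delta> + v * \<epsilon> = gcd \<delta> \<epsilon>" using bezout_int by blast
  have "is_shift q k\<^sub>0 (n * u * \<delta> + n * v * \<epsilon>)" for n
    by (intro is_shift_add is_shift_int_mult assms)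
  from this[of 1] this[of "- 1"] show ?thesis by (simp flip: uv)
qed

section \<open>Computing Dedekind sums\<close>

text \<open>The integer \<open>b S(a, b)\<close>, computed by reciprocity along Euclid's algorithm.
  For coprime arguments the recursion ends at \<open>a = 0\<close>, \<open>b = 1\<close>, where the
  value is indeed \<open>0\<close>.\<close>

function dedekind_numerator :: "int \<Rightarrow> int \<Rightarrow> int" where
  "dedekind_numerator a b =
    (if a \<le> 0 then 0
     else (a * a + b * b + 1 - 3 * a * b - b * dedekind_numerator (b mod a) a) div a)"
  by auto
termination by (relation "measure (nat \<circ> fst)") auto

declare dedekind_numerator.simps [simp del]

text \<open>Multiply the Rademacher number of a matrix with bottom row \<open>(b, a)\<close> by
  \<open>b\<close>: integrality of that number makes \<open>b S(a, b)\<close> an integer.\<close>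

lemma ndsum_denominator:
  assumes "b > 0" "coprime a b"
  shows "\<exists>m :: int. of_int b * ndsum a (nat b) = of_int m"
proof -
  obtain u v where "u * a + v * b = 1"
    using bezout_int[of a b] assms(2) by (metis coprime_iff_gcd_eq_1)
  then have "u * a - (- v) * b = 1" by simp
  then obtain t where "rademacher u (- v) b a = of_int t"
    using rademacher_int by (metis Ints_cases)
  then have "of_int b * ndsum a (nat b) = of_int (u + a - b * t)"
    using assms(1) by (simp add: rademacher_def field_simps)
  then show ?thesis by blast
qed

lemma dedekind_numerator:
  assumes "0 \<le> a" "0 < b" "coprime a b"
  shows "of_int (dedekind_numerator a b) = of_int b * ndsum a (nat b)"
  using assms
proof (induction "nat a" arbitrary: a b rule: less_induct)
  case less
  show ?case
  proof (cases "a = 0")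
    case True
    then have "b = 1" using less.prems by simp
    then show ?thesis using True by (simp add: dedekind_numerator.simps)
  next
    case False
    then have a: "a > 0" using less.prems by simp
    \<comment> \<open>Knowing beforehand that \<open>b S(a, b)\<close> is an integer shows that the
      division by \<open>a\<close> in the recursion is exact.\<close>
    obtain m where m: "of_int b * ndsum a (nat b) = of_int m"
      using ndsum_denominator less.prems by blast
    have cop: "coprime (b mod a) a" using less.prems(3) a
      by (simp add: coprime_commute coprime_mod_left_iff)
    have "of_int (dedekind_numerator (b mod a) a) = of_int a * ndsum (b mod a) (nat a)"
      using a cop by (intro less.hyps) auto
    also have "ndsum (b mod a) (nat a) = ndsum b (nat a)"
      using a by (intro ndsum_cong) (auto simp: cong_def)
    finally have IH: "of_int (dedekind_numerator (b mod a) a) = of_int a * ndsum b (nat a)" .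
    have "ndsum b (nat a) + ndsum a (nat b) = of_int b / of_int a + of_int a / of_int b + 1 / of_int (b * a) - 3"
      using ndsum_reciprocity_int[of b a] a less.prems by (simp add: coprime_commute)
    then have "of_int a * (of_int b * ndsum a (nat b)) =
      of_int (a * a + b * b + 1 - 3 * a * b) - of_int b * (of_int a * ndsum b (nat a))"
      using a less.prems(2) by (simp add: field_simps)
    then have "real_of_int (a * m) = of_int (a * a + b * b + 1 - 3 * a * b - b * dedekind_numerator (b mod a) a)"
      unfolding m IH[symmetric] by simp
    then have "a * m = a * a + b * b + 1 - 3 * a * b - b * dedekind_numerator (b mod a) a"
      by (simp only: of_int_eq_iff)
    then have "dedekind_numerator a b = m"
      using a by (subst dedekind_numerator.simps) (simp flip: \<open>a * m = _\<close>)
    with m show ?thesis by simp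
  qed
qed

definition shift_of :: "int \<Rightarrow> int \<Rightarrow> int \<Rightarrow> int \<Rightarrow> int" where
  "shift_of q k r s =
    (dedekind_numerator s (q * r) - dedekind_numerator ((s + k * r) mod (q * r)) (q * r)) div (q * r)"

definition shift_ok :: "int \<Rightarrow> int \<Rightarrow> int \<times> int \<Rightarrow> bool" where
  "shift_ok q k = (\<lambda>(r, s). 0 < r \<and> 0 \<le> s \<and> gcd s r = 1 \<and> (s * (s + k * r) - 1) mod q = 0 \<and>
     (dedekind_numerator s (q * r) - dedekind_numerator ((s + k * r) mod (q * r)) (q * r)) mod (q * r) = 0)"

text \<open>The congruence makes \<open>s\<close> and \<open>s + k r\<close> units modulo
  \<open>q\<close>; together with \<open>gcd s r = 1\<close> both are coprime to \<open>q r\<close>.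
  Hence the two numerators are Dedekind sums times \<open>q r\<close>, and their exact quotient is
  the shift.\<close>

lemma shift_ok:
  assumes "q > 0" "coprime k q" "shift_ok q k (r, s)"
  shows "is_shift q k (shift_of q k r s) \<and> is_shift q k (- shift_of q k r s)"
proof -
  have h: "0 < r" "0 \<le> s" "gcd s r = 1" "(s * (s + k * r) - 1) mod q = 0"
    "(dedekind_numerator s (q * r) - dedekind_numerator ((s + k * r) mod (q * r)) (q * r)) mod (q * r) = 0"
    using assms(3) by (simp_all add: shift_ok_def)
  have qdvd: "q dvd s * (s + k * r) - 1" using h(4) by (simp add: dvd_eq_mod_eq_0)
  have c: "[s * (s + k * r) = 1] (mod q)" using qdvd by (simp add: cong_iff_dvd_diff)
  have "coprime s q \<and> coprime (s + k * r) q"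
    using c by (metis coprime_iff_invertible_int mult.commute)
  moreover have sr: "coprime s r" using h(3) by (simp add: coprime_iff_gcd_eq_1)
  moreover have "gcd (s + k * r) r = gcd s r" by (metis gcd_add_mult gcd.commute add.commute)
  then have "coprime (s + k * r) r" using sr by (simp add: coprime_iff_gcd_eq_1)
  ultimately have cop: "coprime s (q * r)" "coprime (s + k * r) (q * r)" by simp_all
  have pos: "q * r > 0" using assms(1) h(1) by simp
  have "coprime ((s + k * r) mod (q * r)) (q * r)"
    using coprime_mod_left_iff[of "q * r" "s + k * r"] cop(2) pos by (metis less_irrefl)
  then have "of_int (dedekind_numerator ((s + k * r) mod (q * r)) (q * r)) =
      of_int (q * r) * ndsum ((s + k * r) mod (q * r)) (nat (q * r))"
    using pos by (intro dedekind_numerator) auto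
  also have "ndsum ((s + k * r) mod (q * r)) (nat (q * r)) = ndsum (s + k * r) (nat (q * r))"
    using pos by (intro ndsum_cong) (auto simp: cong_def)
  finally have 1: "of_int (dedekind_numerator ((s + k * r) mod (q * r)) (q * r)) =
      of_int (q * r) * ndsum (s + k * r) (nat (q * r))" .
  have 2: "of_int (dedekind_numerator s (q * r)) = of_int (q * r) * ndsum s (nat (q * r))"
    using pos h(2) cop(1) by (intro dedekind_numerator)
  have "dedekind_numerator s (q * r) - dedekind_numerator ((s + k * r) mod (q * r)) (q * r) = q * r * shift_of q k r s"
    unfolding shift_of_def using h(5) by (simp add: mult_div_mod_eq[symmetric] minus_mod_eq_mult_div flip: minus_mod_eq_mult_div)
  then have "of_int (q * r) * ndsum s (nat (q * r)) - of_int (q * r) * ndsum (s + k * r) (nat (q * r)) = of_int (q * r * shift_of q k r s)"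
    unfolding 1[symmetric] 2[symmetric] by (metis of_int_diff)
  then have "of_int (q * r) * (ndsum s (nat (q * r)) - ndsum (s + k * r) (nat (q * r))) = of_int (q * r) * real_of_int (shift_of q k r s)"
    by (simp add: right_diff_distrib)
  then have "ndsum s (nat (q * r)) - ndsum (s + k * r) (nat (q * r)) = of_int (shift_of q k r s)"
    using pos mult_cancel_left by (metis of_int_0_eq_iff less_irrefl)
  then show ?thesis using is_shift_both[OF assms(1,2) h(1) cop(1) c] by blast
qed

lemma shift_ok_list:
  assumes "q > 0" "coprime k q" "list_all (shift_ok q k) xs"
  defines "m \<equiv> foldr gcd (map (\<lambda>(r, s). shift_of q k r s) xs) 0"
  shows "is_shift q k m \<and> is_shift q k (- m)"
  using assms(3) unfolding m_def
proof (induction xs)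
  case Nil
  then show ?case by (simp add: is_shift_def)
next
  case (Cons x xs)
  then show ?case using shift_ok[OF assms(1,2)] by (cases x) (auto intro!: is_shift_gcd)
qed

text \<open>The last equation is \<open>S(a, q g) = k/q\<close> multiplied by \<open>q g\<close>, so
  that it can be checked in integers.\<close>

definition base_ok :: "int \<Rightarrow> int \<times> int \<times> int \<Rightarrow> bool" where
  "base_ok q = (\<lambda>(k, a, g). 0 \<le> a \<and> 0 < g \<and> gcd a (q * g) = 1 \<and> dedekind_numerator a (q * g) = g * k)"

lemma base_ok:
  assumes "q > 0" "base_ok q (k, a, g)"
  shows "is_value q k"
proof -
  have h: "0 \<le> a" "0 < g" "gcd a (q * g) = 1" "dedekind_numerator a (q * g) = g * k"
    using assms(2) by (simp_all add: base_ok_def)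
  have pos: "q * g > 0" using assms(1) h(2) by simp
  have cop: "coprime a (q * g)" using h(3) by (simp add: coprime_iff_gcd_eq_1)
  have "of_int (g * k) = of_int (q * g) * ndsum a (nat (q * g))"
    using dedekind_numerator[OF h(1) pos cop] h(4) by simp
  then have "of_int k / of_int q = ndsum a (nat (q * g))"
    using assms(1) h(2) by (simp add: field_simps)
  moreover have "nat (q * g) \<ge> 1" using pos by linarith
  moreover have "coprime a (int (nat (q * g)))" using cop pos by simp
  ultimately show ?thesis unfolding is_value_def is_normalized_dedekind_value_def by blast
qed

section \<open>Gauss's lemma for odd moduli\<close>

text \<open>For odd \<open>n\<close>, the sign of the absolutely least residue of \<open>x\<close>;
  \<open>half_residue\<close> is its absolute value.\<close>

definition half_sign :: "nat \<Rightarrow> int \<Rightarrow> int" where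
  "half_sign n x = (if x mod int n \<le> int (n div 2) then 1 else - 1)"

definition gauss_sign :: "nat \<Rightarrow> int \<Rightarrow> int" where
  "gauss_sign n m = (\<Prod>j = 1..n div 2. half_sign n (m * int j))"

definition half_residue :: "nat \<Rightarrow> int \<Rightarrow> nat" where
  "half_residue n x = nat (if x mod int n \<le> int (n div 2) then x mod int n else int n - x mod int n)"

lemma half_sign_cases: "half_sign n x = 1 \<or> half_sign n x = - 1"
  by (simp add: half_sign_def)

lemma half_residue_mem:
  assumes "odd n" "\<not> int n dvd x"
  shows "half_residue n x \<in> {1..n div 2}"
proof -
  define y where "y = x mod int n"
  have "n > 0" using assms(1) by (rule odd_pos)
  then have "0 \<le> y" "y < int n" by (simp_all add: y_def)
  moreover have "y \<noteq> 0" using assms(2) by (simp add: dvd_eq_mod_eq_0 y_def)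
  moreover have "int n = 2 * int (n div 2) + 1" using assms(1) by (metis odd_two_times_div_two_succ of_nat_add of_nat_mult of_nat_numeral of_nat_1)
  ultimately show ?thesis unfolding half_residue_def y_def[symmetric] by auto
qed

lemma half_residue_cong:
  assumes "n > 0"
  shows "[x = half_sign n x * int (half_residue n x)] (mod int n)"
proof -
  have "0 \<le> x mod int n" "x mod int n < int n" using assms by simp_all
  then show ?thesis unfolding half_residue_def half_sign_def cong_def
    by (auto simp: mod_diff_right_eq)
qed

lemma half_sign_cong: "[x = y] (mod int n) \<Longrightarrow> half_sign n x = half_sign n y"
  by (simp add: half_sign_def cong_def)

lemma half_sign_minus:
  assumes "odd n" "\<not> int n dvd x"
  shows "half_sign n (- x) = - half_sign n x"
proof -
  have "n > 0" using assms(1) by (rule odd_pos)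
  then have "0 \<le> x mod int n" "x mod int n < int n" by simp_all
  moreover have "(- x) mod int n = int n - x mod int n" using assms(2) by (simp add: zmod_zminus1_eq_if dvd_eq_mod_eq_0)
  moreover have "int n = 2 * int (n div 2) + 1" using assms(1) by (metis odd_two_times_div_two_succ of_nat_add of_nat_mult of_nat_numeral of_nat_1)
  ultimately show ?thesis unfolding half_sign_def by auto
qed

lemma not_dvd_mult_half:
  assumes "coprime m (int n)" "j \<in> {1..n div 2}"
  shows "\<not> int n dvd m * int j"
proof
  assume "int n dvd m * int j"
  then have "int n dvd int j" using assms(1) by (simp add: coprime_commute coprime_dvd_mult_right_iff)
  then have "n \<le> j" using assms(2) by (simp add: dvd_imp_le)
  then show False using assms(2) by auto
qed

text \<open>The permutation behind Gauss's lemma: equal half residues give \<open>m (i - j)\<close>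
  or \<open>m (i + j)\<close> divisible by \<open>n\<close>. The second is impossible because
  \<open>0 < i + j < n\<close>.\<close>

lemma bij_half_residue:
  assumes "odd n" "coprime m (int n)"
  shows "bij_betw (\<lambda>j. half_residue n (m * int j)) {1..n div 2} {1..n div 2}"
proof -
  have n: "n > 0" using assms(1) by (rule odd_pos)
  have inj: "inj_on (\<lambda>j. half_residue n (m * int j)) {1..n div 2}"
  proof (rule inj_onI)
    fix i j assume i: "i \<in> {1..n div 2}" and j: "j \<in> {1..n div 2}"
      and e: "half_residue n (m * int i) = half_residue n (m * int j)"
    let ?r = "int (half_residue n (m * int i))"
    have "[m * int i = half_sign n (m * int i) * ?r] (mod int n)" "[m * int j = half_sign n (m * int j) * ?r] (mod int n)"
      using half_residue_cong[OF n] e by metis+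
    then have "int n dvd m * int i - half_sign n (m * int i) * ?r" "int n dvd m * int j - half_sign n (m * int j) * ?r"
      by (simp_all add: cong_iff_dvd_diff)
    then have "int n dvd m * (int i - int j) \<or> int n dvd m * (int i + int j)"
    proof -
      assume a: "int n dvd m * int i - half_sign n (m * int i) * ?r" and b: "int n dvd m * int j - half_sign n (m * int j) * ?r"
      show ?thesis
      proof (cases "half_sign n (m * int i) = half_sign n (m * int j)")
        case True
        with dvd_diff[OF a b] show ?thesis by (simp add: algebra_simps)
      next
        case False
        then have "half_sign n (m * int j) = - half_sign n (m * int i)" using half_sign_cases by (metis minus_minus)
        with dvd_add[OF a b] show ?thesis by (simp add: algebra_simps)
      qed
    qed
    then have "int n dvd int i - int j \<or> int n dvd int i + int j"
      using assms(2) by (simp add: coprime_commute coprime_dvd_mult_right_iff)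
    moreover have "\<not> int n dvd int i + int j"
    proof
      assume "int n dvd int i + int j"
      then have "int n \<le> int i + int j" using i by (auto dest: zdvd_imp_le)
      moreover have "n = 2 * (n div 2) + 1" using assms(1) by simp
      ultimately show False using i j by auto
    qed
    ultimately have "int n dvd int i - int j" by blast
    moreover have "\<bar>int i - int j\<bar> < int n" using i j n by auto
    ultimately show "i = j" using dvd_imp_le_int[of "int i - int j" "int n"] by force
  qed
  have "(\<lambda>j. half_residue n (m * int j)) ` {1..n div 2} \<subseteq> {1..n div 2}"
    using half_residue_mem[OF assms(1) not_dvd_mult_half[OF assms(2)]] by blast
  with inj show ?thesis by (simp add: bij_betw_def endo_inj_surj)
qed

text \<open>Write \<open>l j\<close> as a sign times its half residue. The signs multiply, and the
  half residues run through \<open>1, ..., n div 2\<close> once more, now to be multiplied by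
  \<open>m\<close>.\<close>

lemma gauss_sign_mult:
  assumes "odd n" "coprime m (int n)" "coprime l (int n)"
  shows "gauss_sign n (m * l) = gauss_sign n m * gauss_sign n l"
proof -
  have n: "n > 0" using assms(1) by (rule odd_pos)
  have "half_sign n (m * l * int j) = half_sign n (m * int (half_residue n (l * int j))) * half_sign n (l * int j)"
    if j: "j \<in> {1..n div 2}" for j
  proof -
    let ?r = "half_residue n (l * int j)"
    have r: "?r \<in> {1..n div 2}" by (rule half_residue_mem[OF assms(1) not_dvd_mult_half[OF assms(3) j]])
    have "[m * (l * int j) = m * (half_sign n (l * int j) * int ?r)] (mod int n)"
      by (intro cong_mult cong_refl half_residue_cong n)
    then have "half_sign n (m * l * int j) = half_sign n (half_sign n (l * int j) * (m * int ?r))"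
      by (intro half_sign_cong) (simp add: algebra_simps)
    then show ?thesis
      using half_sign_cases[of n "l * int j"] half_sign_minus[OF assms(1) not_dvd_mult_half[OF assms(2) r]] by auto
  qed
  then have "gauss_sign n (m * l) = (\<Prod>j = 1..n div 2. half_sign n (m * int (half_residue n (l * int j))) * half_sign n (l * int j))"
    unfolding gauss_sign_def by (intro prod.cong) auto
  also have "\<dots> = gauss_sign n m * gauss_sign n l"
    unfolding prod.distrib gauss_sign_def
    using prod.reindex_bij_betw[OF bij_half_residue[OF assms(1,3)], of "\<lambda>i. half_sign n (m * int i)"] by simp
  finally show ?thesis .
qed

text \<open>The sum is twice the number of minus signs, so modulo 4 only the parity of that number
  matters, and the product records this parity.\<close>

lemma sum_one_minus_sign_cong:
  fixes f :: "nat \<Rightarrow> int"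
  assumes "\<And>j. f j = 1 \<or> f j = - 1"
  shows "(\<Prod>j\<in>A. f j) \<in> {1, - 1} \<and> [(\<Sum>j\<in>A. 1 - f j) = 1 - (\<Prod>j\<in>A. f j)] (mod 4)"
proof (induction A rule: infinite_finite_induct)
  case (insert x A)
  from insert.IH obtain t where t: "(\<Sum>j\<in>A. 1 - f j) = 1 - (\<Prod>j\<in>A. f j) + 4 * t"
    by (metis cong_iff_lin cong_sym)
  have "4 dvd (\<Sum>j\<in>insert x A. 1 - f j) - (1 - (\<Prod>j\<in>insert x A. f j))"
    using insert t assms[of x] by auto
  then show ?case using insert assms[of x] by (auto simp: cong_iff_dvd_diff)
qed auto

lemma gauss_sign_cases: "gauss_sign n m = 1 \<or> gauss_sign n m = - 1"
  using sum_one_minus_sign_cong[of "\<lambda>j. half_sign n (m * int j)" "{1..n div 2}", OF half_sign_cases]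
  unfolding gauss_sign_def by blast

text \<open>Since the sign of Gauss's lemma is the Jacobi symbol, this is the classical congruence
  \<open>12 n s(m, n) \<equiv> n + 1 - 2 (m/n) (mod 8)\<close> multiplied by \<open>n\<close>.\<close>

lemma centred_sum_mod_8:
  assumes n: "odd n" and m: "coprime m (int n)"
  shows "[3 * centred_sum m n = 3 * (int n - 1) + 6 * (1 - gauss_sign n m)] (mod 8)"
proof -
  let ?p = "n div 2"
  let ?t = "\<lambda>j. (2 * int j - int n) * (2 * ((m * int j) mod int n) - int n)"
  let ?h = "\<lambda>j. half_sign n (m * int j)" and ?r = "\<lambda>j. half_residue n (m * int j)"
  have np: "n = 2 * ?p + 1" using n by simp
  have n0: "n > 0" using n by (rule odd_pos)
  \<comment> \<open>Reflection \<open>j \<mapsto> n - j\<close> negates both centred factors. The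
    full sum is therefore twice a half sum, and a congruence modulo 4 for the latter
    suffices.\<close>
  have refl: "?t (n - j) = ?t j" if "j \<in> {1..?p}" for j
  proof -
    have j: "j \<le> n" using that by auto
    have "(m * (int n - int j)) mod int n = (- (m * int j)) mod int n"
      by (metis add.commute diff_conv_add_uminus mod_mult_self2 mult.commute right_diff_distrib)
    also have "\<dots> = int n - (m * int j) mod int n"
      using not_dvd_mult_half[OF m that] by (simp add: zmod_zminus1_eq_if dvd_eq_mod_eq_0)
    finally have x: "(m * (int n - int j)) mod int n = int n - (m * int j) mod int n" .
    have "int (n - j) = int n - int j" using j by (rule of_nat_diff)
    moreover have "(2 * (A - J) - A) * (2 * (A - X) - A) = (2 * J - A) * (2 * X - A)" for A J X :: int
      by algebra
    ultimately show ?thesis by (simp only: x)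
  qed
  have "{1..<n} = {1..?p} \<union> (\<lambda>j. n - j) ` {1..?p}"
  proof safe
    fix j assume j: "j \<in> {1..<n}" and nin: "j \<notin> (\<lambda>j. n - j) ` {1..?p}"
    have "j \<le> ?p"
    proof (rule ccontr)
      assume "\<not> j \<le> ?p"
      then have "n - j \<in> {1..?p}" "j = n - (n - j)" using j np by auto
      then show False using nin by blast
    qed
    then show "j \<in> {1..?p}" using j by simp
  qed (use np in auto)
  moreover have "{1..?p} \<inter> (\<lambda>j. n - j) ` {1..?p} = {}" using np by auto
  moreover have "inj_on (\<lambda>j. n - j) {1..?p}" by (rule inj_onI) auto
  ultimately have "centred_sum m n = (\<Sum>j = 1..?p. ?t j) + (\<Sum>j = 1..?p. ?t (n - j))"
    unfolding centred_sum_def by (simp add: sum.union_disjoint sum.reindex)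
  also have "(\<Sum>j = 1..?p. ?t (n - j)) = (\<Sum>j = 1..?p. ?t j)"
    by (intro sum.cong refl) auto
  finally have c: "centred_sum m n = 2 * (\<Sum>j = 1..?p. ?t j)" by simp
  \<comment> \<open>Modulo 4 a summand depends on \<open>j\<close> and the half residue only through
    their doubled sum, and otherwise on the sign.\<close>
  have summand: "[?t j = 1 + 2 * (int j + int (?r j)) + (1 - ?h j)] (mod 4)" if j: "j \<in> {1..?p}" for j
  proof -
    let ?x = "(m * int j) mod int n"
    have x: "0 \<le> ?x" "?x < int n" using n0 by simp_all
    obtain w where w: "int n = 2 * w + 1" using np by (metis of_nat_1 of_nat_add of_nat_mult of_nat_numeral)
    show ?thesis
    proof (cases "?x \<le> int (n div 2)")
      case True
      then have hr: "?h j = 1" "int (?r j) = ?x" using x by (simp_all add: half_sign_def half_residue_def)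
      have "?t j - (1 + 2 * (int j + ?x) + (1 - 1)) = 4 * (int j * ?x - (w + 1) * (int j + ?x) + w * w + w)"
        unfolding w by algebra
      then show ?thesis unfolding cong_iff_dvd_diff hr by (metis dvd_triv_left)
    next
      case False
      then have hr: "?h j = - 1" "int (?r j) = int n - ?x" using x by (simp_all add: half_sign_def half_residue_def)
      have "?t j - (1 + 2 * (int j + (int n - ?x)) + (1 - - 1)) = 4 * (int j * ?x - w * ?x - (w + 1) * int j + w * w - 1)"
        unfolding w by algebra
      then show ?thesis unfolding cong_iff_dvd_diff hr by (metis dvd_triv_left)
    qed
  qed
  have "[(\<Sum>j = 1..?p. ?t j) = (\<Sum>j = 1..?p. 1 + 2 * (int j + int (?r j)) + (1 - ?h j))] (mod 4)"
    by (intro cong_sum summand)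
  also have "(\<Sum>j = 1..?p. 1 + 2 * (int j + int (?r j)) + (1 - ?h j)) =
     int ?p + 2 * ((\<Sum>j = 1..?p. int j) + (\<Sum>j = 1..?p. int (?r j))) + (\<Sum>j = 1..?p. 1 - ?h j)"
    by (simp only: sum.distrib sum_distrib_left[symmetric]) simp
  \<comment> \<open>The half residues are a permutation, so the doubled sums add up to a multiple of
    4 and disappear.\<close>
  also have "(\<Sum>j = 1..?p. int (?r j)) = (\<Sum>j = 1..?p. int j)"
    using sum.reindex_bij_betw[OF bij_half_residue[OF n m], of int] .
  also have "[int ?p + 2 * ((\<Sum>j = 1..?p. int j) + (\<Sum>j = 1..?p. int j)) + (\<Sum>j = 1..?p. 1 - ?h j) =
     int ?p + 0 + (1 - gauss_sign n m)] (mod 4)"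
    unfolding gauss_sign_def
    by (intro cong_add cong_refl conjunct2[OF sum_one_minus_sign_cong] half_sign_cases) (simp add: cong_iff_dvd_diff)
  finally have "4 dvd (\<Sum>j = 1..?p. ?t j) - (int ?p + 0 + (1 - gauss_sign n m))" by (simp add: cong_iff_dvd_diff)
  then obtain u where u: "(\<Sum>j = 1..?p. ?t j) - (int ?p + 0 + (1 - gauss_sign n m)) = 4 * u" by (rule dvdE)
  have "int n = 2 * int ?p + 1" using np by presburger
  then have "3 * centred_sum m n - (3 * (int n - 1) + 6 * (1 - gauss_sign n m)) = 8 * (3 * u)"
    using u unfolding c by algebra
  then show ?thesis by (simp only: cong_iff_dvd_diff dvd_triv_left)
qed

section \<open>Necessary conditions\<close>

lemma odd_square_mod_8:
  assumes "odd (x :: int)"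
  obtains u where "x * x = 1 + 8 * u"
proof -
  obtain w where w: "x = 2 * w + 1" using assms by (rule oddE)
  have "even (w * (w + 1))" by simp
  then obtain u where u: "w * (w + 1) = 2 * u" by (rule evenE)
  have "x * x = 1 + 8 * u" using u unfolding w by algebra
  then show ?thesis by (rule that)
qed

text \<open>The matrix (-a, -h; g, a) has trace \<open>0\<close> and Rademacher number
  \<open>- S(a, g)\<close>. Its inverse has Rademacher number \<open>S(- a, g) = - S(a, g)\<close>
  as well, but inversion changes the sign.\<close>

lemma ndsum_eq_0:
  assumes "g > 0" "a * a + 1 = g * h"
  shows "ndsum a (nat g) = 0"
proof -
  have det: "(- a) * a - (- h) * g = 1" using assms(2) by (simp add: algebra_simps)
  have m: "ndsum (- a) (nat g) = - ndsum a (nat g)" using assms(1) by (intro ndsum_minus) simp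
  have "rademacher a h (- g) (- a) = - rademacher (- a) (- h) g a"
    using rademacher_inverse[OF det] by simp
  then show ?thesis using assms(1) m by (simp add: rademacher_def)
qed

lemma value_mod_3:
  assumes "q > 0" "coprime k q" "is_value q k" "\<not> 3 dvd q"
  shows "3 dvd k"
proof -
  from assms(3) obtain d b where db: "b \<ge> 1" "coprime d (int b)" "ndsum d b = of_int k / of_int q"
    unfolding is_value_def is_normalized_dedekind_value_def by metis
  then have b0: "b > 0" by simp
  obtain a x g where g: "g > 0" "int b = q * g" "a * d - x * (q * g) = 1" "a + d = g * k"
    using ndsum_valueE[OF assms(1,2) b0 db(2,3)] by metis
  have "g * (d * k - x * q) = d * d + 1"
    using g(3,4) by algebra
  \<comment> \<open>-1 is not a square modulo 3, which keeps 3 out of the cofactor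
    \<open>g\<close>.\<close>
  moreover have "\<not> 3 dvd d * d + 1"
  proof -
    obtain z r where d: "d = 3 * z + r" and r: "r = 0 \<or> r = 1 \<or> r = 2"
    proof
      show "d = 3 * (d div 3) + d mod 3" by simp
      show "d mod 3 = 0 \<or> d mod 3 = 1 \<or> d mod 3 = 2" by presburger
    qed
    have "d * d + 1 = 3 * (3 * z * z + 2 * z * r) + (r * r + 1)" unfolding d by algebra
    then have "3 dvd d * d + 1 \<longleftrightarrow> 3 dvd r * r + 1" by (metis dvd_add_right_iff dvd_triv_left)
    with r show ?thesis by auto
  qed
  ultimately have g3: "\<not> 3 dvd g" by (metis dvd_mult2)
  have "real b = of_int (q * g)" using g(2) by (metis of_int_of_nat_eq)
  then have "of_int (q * g) ^ 2 * (of_int k / of_int q) = real_of_int (3 * centred_sum d b)"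
    using ndsum_centred[OF b0 db(2)] db(3) by simp
  then have "real_of_int (q * g ^ 2 * k) = of_int (3 * centred_sum d b)"
    using assms(1) by (simp add: power2_eq_square mult_ac)
  then have "q * g ^ 2 * k = 3 * centred_sum d b" by (simp only: of_int_eq_iff)
  then have "3 dvd q * g ^ 2 * k" by simp
  moreover have "prime (3 :: int)" by simp
  ultimately show ?thesis using assms(4) g3 by (auto simp: prime_dvd_mult_iff prime_dvd_power_iff)
qed

text \<open>\<open>d\<close> is replaced by a positive odd representative \<open>n\<close> modulo
  \<open>b = q g\<close>. Two reciprocity laws, for \<open>(n, q g)\<close> and for
  \<open>(n, g)\<close> with \<open>S(n, g) = 0\<close>, reduce \<open>k\<close> to Dedekind sums
  with odd denominator \<open>n\<close>, which are known modulo 8 up to Gauss signs.\<close>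

lemma value_mod_8:
  assumes q: "q > 0" "odd q" and k: "coprime k q" and v: "is_value q k"
  obtains n g where "odd n" "coprime q (int n)" "coprime g (int n)"
    "[k = - 3 * int n * (q - 1) - 6 * q * (1 - gauss_sign n (q * g)) + 6 * (1 - gauss_sign n g)] (mod 8)"
proof -
  from v obtain d b where db: "b \<ge> 1" "coprime d (int b)" "ndsum d b = of_int k / of_int q"
    unfolding is_value_def is_normalized_dedekind_value_def by metis
  then have b0: "b > 0" by simp
  obtain a x g where g: "g > 0" "int b = q * g" "a * d - x * (q * g) = 1" "a + d = g * k"
    using ndsum_valueE[OF q(1) k b0 db(2,3)] by metis
  have gd: "g dvd d * d + 1"
  proof
    show "d * d + 1 = g * (d * k - x * q)" using g(3,4) by algebra
  qed
  \<comment> \<open>If \<open>d\<close> is even then \<open>b\<close> is odd, so adding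
    \<open>b\<close> corrects the parity. The term \<open>2 b |d|\<close> makes the result
    nonnegative and preserves parity and residue.\<close>
  define e where "e = (if odd d then d else d + int b) + 2 * int b * \<bar>d\<bar>"
  have "odd d \<or> odd (int b)" using db(2) by (metis coprime_common_divisor odd_one)
  then have e_odd: "odd e" unfolding e_def by auto
  have "\<bar>d\<bar> \<le> int b * \<bar>d\<bar>" using b0 by (simp add: mult_le_cancel_right1)
  moreover have "e = (if odd d then d else d + int b) + 2 * (int b * \<bar>d\<bar>)" unfolding e_def by simp
  ultimately have "e \<ge> 0" by (smt (verit) of_nat_0_le_iff)
  then have e0: "e > 0" using e_odd by (metis even_zero order_le_less)
  obtain w where ew: "e = d + int b * w"
  proof
    show "e = d + int b * ((if odd d then 0 else 1) + 2 * \<bar>d\<bar>)" unfolding e_def by (simp add: algebra_simps)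
  qed
  define n where "n = nat e"
  have ne: "int n = e" using e0 by (simp add: n_def)
  have n0: "n > 0" using e0 by (simp add: n_def)
  have n_odd: "odd n" using e_odd ne by (metis even_of_nat)
  have cong: "[int n = d] (mod int b)" unfolding ne ew by (simp add: cong_def)
  have cop: "coprime (int n) (int b)" using cong db(2) by (metis cong_imp_coprime cong_sym)
  then have cop': "coprime n b" by simp
  have copq: "coprime q (int n)" and copg: "coprime g (int n)" using cop unfolding g(2) by (simp_all add: coprime_commute)
  have val: "ndsum (int n) b = of_int k / of_int q" using ndsum_cong[OF cong b0] db(3) by simp
  have "int n * int n + 1 = d * d + 1 + g * (q * w * (2 * d + int b * w))"
    unfolding ne ew g(2) by algebra
  then have "g dvd int n * int n + 1" using gd by (metis dvd_add dvd_triv_left)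
  then obtain h where h: "int n * int n + 1 = g * h" by blast
  have "\<exists>Y :: int. real n * ndsum (int b) n = of_int Y"
    using ndsum_denominator[of "int n" "int b"] n0 cop by (simp add: coprime_commute)
  then obtain Y :: int where Y: "real n * ndsum (int b) n = of_int Y" by blast
  have "\<exists>Z :: int. real n * ndsum g n = of_int Z"
    using ndsum_denominator[of "int n" g] n0 copg by simp
  then obtain Z :: int where Z: "real n * ndsum g n = of_int Z" by blast
  have nb: "real b = of_int q * of_int g" using g(2) by (metis of_int_mult of_int_of_nat_eq)
  have hR: "real n * real n + 1 = of_int g * of_int h"
    using h by (metis of_int_1 of_int_add of_int_mult of_int_of_nat_eq)
  have "ndsum (int n) b + ndsum (int b) n = real n / real b + real b / real n + 1 / (real n * real b) - 3"
    by (rule ndsum_reciprocity[OF n0 b0 cop'])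
  then have "real n * real b * (of_int k / of_int q) + real b * (real n * ndsum (int b) n) = real n * real n + 1 + real b * real b - 3 * real n * real b"
    unfolding val using n0 b0 by (simp add: field_simps)
  then have "real n * (of_int q * of_int g) * (of_int k / of_int q) + of_int q * of_int g * of_int Y = of_int g * of_int h + (of_int q * of_int g) * (of_int q * of_int g) - 3 * real n * (of_int q * of_int g)"
    using Y unfolding hR nb by simp
  then have "of_int g * real_of_int (int n * k + q * Y) = of_int g * real_of_int (h + q * q * g - 3 * int n * q)"
    using q(1) by (simp add: algebra_simps)
  then have 1: "int n * k + q * Y = h + q * q * g - 3 * int n * q"
    using g(1) by (simp only: mult_cancel_left of_int_eq_iff of_int_eq_0_iff) simp
  have "ndsum (int n) (nat g) = 0" using ndsum_eq_0[OF g(1) h] .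
  moreover have "ndsum (int n) (nat g) + ndsum g n = real n / of_int g + of_int g / real n + 1 / (real n * of_int g) - 3"
    using ndsum_reciprocity[OF n0, of "nat g"] g(1) copg by (simp add: coprime_commute flip: coprime_int_iff)
  ultimately have "of_int g * (real n * ndsum g n) = real n * real n + 1 + of_int g * of_int g - 3 * real n * of_int g"
    using n0 g(1) by (simp add: field_simps)
  then have "of_int g * real_of_int Z = of_int g * real_of_int (h + g - 3 * int n)"
    using Z unfolding hR by (simp add: algebra_simps)
  then have 2: "Z = h + g - 3 * int n"
    using g(1) by (simp only: mult_cancel_left of_int_eq_iff of_int_eq_0_iff) simp
  have "real_of_int (int n * Y) = of_int (3 * centred_sum (int b) n)"
    using ndsum_centred[OF n0, of "int b"] Y cop by (simp add: coprime_commute power2_eq_square mult.assoc)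
  then have "int n * Y = 3 * centred_sum (q * g) n" unfolding g(2) by (simp only: of_int_eq_iff)
  then have "[int n * Y = 3 * (int n - 1) + 6 * (1 - gauss_sign n (q * g))] (mod 8)"
    using centred_sum_mod_8[OF n_odd, of "q * g"] copq copg by simp
  then obtain u where u: "int n * Y = 3 * (int n - 1) + 6 * (1 - gauss_sign n (q * g)) + 8 * u"
    by (metis cong_iff_lin cong_sym)
  have "real_of_int (int n * Z) = of_int (3 * centred_sum g n)"
    using ndsum_centred[OF n0, of g] Z copg by (simp add: power2_eq_square mult.assoc)
  then have "int n * Z = 3 * centred_sum g n" by (simp only: of_int_eq_iff)
  then have "[int n * Z = 3 * (int n - 1) + 6 * (1 - gauss_sign n g)] (mod 8)"
    using centred_sum_mod_8[OF n_odd copg] by simp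
  then obtain t where t: "int n * Z = 3 * (int n - 1) + 6 * (1 - gauss_sign n g) + 8 * t"
    by (metis cong_iff_lin cong_sym)
  obtain \<alpha> where \<alpha>: "int n * int n = 1 + 8 * \<alpha>" using odd_square_mod_8[of "int n"] n_odd by auto
  obtain \<beta> where \<beta>: "q * q = 1 + 8 * \<beta>" using odd_square_mod_8[OF q(2)] by auto
  \<comment> \<open>Multiply both integral reciprocity relations by \<open>n\<close> and subtract:
    \<open>n h\<close> cancels, and the squares of \<open>n\<close> and \<open>q\<close> are 1
    modulo 8.\<close>
  have "k - (- 3 * int n * (q - 1) - 6 * q * (1 - gauss_sign n (q * g)) + 6 * (1 - gauss_sign n g))
    = 8 * (int n * \<beta> * g - 3 * \<alpha> * (q - 1) - q * u + t - \<alpha> * k)"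
    using 1 2 u t \<alpha> \<beta> by algebra
  then have "[k = - 3 * int n * (q - 1) - 6 * q * (1 - gauss_sign n (q * g)) + 6 * (1 - gauss_sign n g)] (mod 8)"
    by (simp only: cong_iff_dvd_diff dvd_triv_left)
  then show ?thesis using that n_odd copq copg by blast
qed

text \<open>The differences \<open>1 - gauss_sign\<close> are even, so modulo 4 only
  \<open>- 3 n (q - 1)\<close> with odd \<open>n\<close> remains. If \<open>q\<close> is a square,
  the two Gauss signs agree by multiplicativity and \<open>q\<close> is 1 modulo 8, so everything
  cancels modulo 8.\<close>

lemma value_mod_4:
  assumes q: "q > 0" "odd q" and k: "coprime k q" and v: "is_value q k"
  shows "q mod 4 = 3 \<Longrightarrow> k mod 4 = 2" and "q mod 4 = 1 \<Longrightarrow> k mod 4 = 0"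
    and "q = m * m \<Longrightarrow> k mod 8 = 0"
proof -
  obtain n g where n: "odd n" "coprime q (int n)" "coprime g (int n)"
    and c: "[k = - 3 * int n * (q - 1) - 6 * q * (1 - gauss_sign n (q * g)) + 6 * (1 - gauss_sign n g)] (mod 8)"
    using value_mod_8[OF assms] by blast
  obtain w where w: "int n = 2 * w + 1" using n(1) by (metis even_of_nat oddE)
  let ?E = "gauss_sign n (q * g)" and ?F = "gauss_sign n g"
  obtain t where t: "k = - 3 * int n * (q - 1) - 6 * q * (1 - ?E) + 6 * (1 - ?F) + 8 * t"
    using c by (metis cong_iff_lin cong_sym)
  have "even (1 - ?E)" "even (1 - ?F)"
    using gauss_sign_cases[of n "q * g"] gauss_sign_cases[of n g] by auto
  then obtain x y where x: "1 - ?E = 2 * x" and y: "1 - ?F = 2 * y" by (metis evenE)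
  have k: "k = - 3 * int n * (q - 1) - 6 * q * (2 * x) + 6 * (2 * y) + 8 * t"
    using t unfolding x y .
  {
    assume "q mod 4 = 3"
    then obtain z where z: "q = 4 * z + 3" by (metis mult_div_mod_eq)
    have "k = 4 * (- 3 * (2 * w + 1) * z - 3 * w - 2 - 3 * (4 * z + 3) * x + 3 * y + 2 * t) + 2"
      using k unfolding w z by algebra
    then show "k mod 4 = 2" by presburger
  next
    assume "q mod 4 = 1"
    then obtain z where z: "q = 4 * z + 1" by (metis mult_div_mod_eq)
    have "k = 4 * (- 3 * (2 * w + 1) * z - 3 * (4 * z + 1) * x + 3 * y + 2 * t)"
      using k unfolding w z by algebra
    then show "k mod 4 = 0" by presburger
  next
    assume m: "q = m * m"
    have mc: "coprime m (int n)" using n(2) m by simp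
    have "gauss_sign n (q * g) = gauss_sign n m * gauss_sign n m * ?F"
      using n mc unfolding m by (simp add: gauss_sign_mult)
    then have EF: "?E = ?F" using gauss_sign_cases[of n m] by auto
    have "odd m" using q(2) m by simp
    then obtain z where z: "q = 1 + 8 * z" using odd_square_mod_8 m by metis
    have "x = y" using x y EF by simp
    have "k = 8 * (- 3 * int n * z - 12 * z * y + t)"
      using k unfolding \<open>x = y\<close> z by algebra
    then show "k mod 8 = 0" by presburger
  }
qed

section \<open>Finite certificates\<close>

text \<open>A period of the admissible numerators \<open>k\<^sub>0 + q t\<close> in
  \<open>t\<close>, and the shift that the certificates generate. For odd nonsquare \<open>q\<close>
  the condition at 2 is only modulo 4 although the shifts are multiples of 8. The admissible
  numerators in a class then form two orbits, hence two bases per entry.\<close>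

definition shift_modulus :: "int \<Rightarrow> int" where
  "shift_modulus q = (if q mod 3 = 0 then 1 else 3) * (if q mod 2 = 0 then 1 else 8)"

text \<open>The odd perfect squares between 2 and 60 are listed, so that the condition can be
  evaluated.\<close>

definition admissible :: "int \<Rightarrow> int \<Rightarrow> bool" where
  "admissible q k \<longleftrightarrow> (q mod 3 \<noteq> 0 \<longrightarrow> k mod 3 = 0) \<and>
    (q mod 2 \<noteq> 0 \<longrightarrow>
      (if q mod 4 = 3 then k mod 4 = 2
       else if q = 9 \<or> q = 25 \<or> q = 49 then k mod 8 = 0 else k mod 4 = 0))"

text \<open>An entry \<open>(k\<^sub>0, shifts, bases)\<close> concerns the numerators \<open>k \<equiv> k\<^sub>0 (mod q)\<close>: a shift \<open>(r, s)\<close> adds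
  \<open>q (S(s, q r) - S(s + k\<^sub>0 r, q r))\<close> to \<open>k\<close>, and a base \<open>(k, a, g)\<close> records \<open>S(a, q g) = k/q\<close>. By the
  symmetry \<open>S(-a, b) = -S(a, b)\<close> only \<open>k\<^sub>0 \<le> q/2\<close> is tabulated.\<close>

definition class_ok :: "int \<Rightarrow> int \<times> (int \<times> int) list \<times> (int \<times> int \<times> int) list \<Rightarrow> bool" where
  "class_ok q = (\<lambda>(k\<^sub>0, shifts, bases).
     list_all (shift_ok q k\<^sub>0) shifts \<and>
     foldr gcd (map (\<lambda>(r, s). shift_of q k\<^sub>0 r s) shifts) 0 = shift_modulus q \<and>
     list_all (base_ok q) bases \<and>
     list_all (\<lambda>t. admissible q (k\<^sub>0 + q * t) \<longrightarrow>
        list_ex (\<lambda>(k, a, g). (k - (k\<^sub>0 + q * t)) mod (q * shift_modulus q) = 0) bases) [0..shift_modulus q - 1])"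

definition table_ok :: "int \<Rightarrow> (int \<times> (int \<times> int) list \<times> (int \<times> int \<times> int) list) list \<Rightarrow> bool" where
  "table_ok q es \<longleftrightarrow> map fst es = filter (\<lambda>k. gcd k q = 1) [0..q div 2] \<and> list_all (class_ok q) es"

lemma is_value_uminus:
  assumes "is_value q k"
  shows "is_value q (- k)"
proof -
  obtain a b where "b \<ge> 1" "coprime a (int b)" "of_int k / of_int q = ndsum a b"
    using assms unfolding is_value_def is_normalized_dedekind_value_def by metis
  then have "b \<ge> 1 \<and> coprime (- a) (int b) \<and> of_int (- k) / of_int q = ndsum (- a) b"
    using ndsum_minus[of b a] by simp
  then show ?thesis unfolding is_value_def is_normalized_dedekind_value_def by blast
qed

lemma admissible_cong:
  assumes "k = k' + q * (shift_modulus q * j)" "admissible q k"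
  shows "admissible q k'"
proof -
  have 3: "k mod 3 = k' mod 3" if "q mod 3 \<noteq> 0"
  proof -
    have "k = k' + 3 * (q * (if q mod 2 = 0 then 1 else 8) * j)" using that assms(1) by (simp add: shift_modulus_def)
    then show ?thesis by presburger
  qed
  have 8: "k mod 8 = k' mod 8 \<and> k mod 4 = k' mod 4" if "q mod 2 \<noteq> 0"
  proof -
    have "k = k' + 8 * (q * (if q mod 3 = 0 then 1 else 3) * j)" using that assms(1) by (simp add: shift_modulus_def)
    then show ?thesis by presburger
  qed
  show ?thesis using assms(2) 3 8 unfolding admissible_def by metis
qed

lemma admissible_uminus: "admissible q k \<Longrightarrow> admissible q (- k)"
proof -
  have "k mod 3 = 0 \<Longrightarrow> (- k) mod 3 = 0" "k mod 4 = 2 \<Longrightarrow> (- k) mod 4 = 2"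
    "k mod 8 = 0 \<Longrightarrow> (- k) mod 8 = 0" "k mod 4 = 0 \<Longrightarrow> (- k) mod 4 = 0"
    by presburger+
  then show "admissible q k \<Longrightarrow> admissible q (- k)" unfolding admissible_def by metis
qed

text \<open>The entry for \<open>k mod q\<close> supplies a base numerator congruent to
  \<open>k\<close> modulo \<open>q * shift_modulus q\<close>, and an integer multiple of the
  generated shift carries it to \<open>k\<close>.\<close>

lemma table_ok_small:
  assumes q: "q > 0" and t: "table_ok q es" and k: "coprime k q" "admissible q k" and small: "k mod q \<le> q div 2"
  shows "is_value q k"
proof -
  define k\<^sub>0 where "k\<^sub>0 = k mod q"
  have "gcd k\<^sub>0 q = 1" using k(1) q by (simp add: k\<^sub>0_def coprime_iff_gcd_eq_1)
  moreover have "k\<^sub>0 \<in> set [0..q div 2]" using small q by (simp add: k\<^sub>0_def)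
  ultimately have "k\<^sub>0 \<in> set (map fst es)" using t by (simp add: table_ok_def)
  then obtain shifts bases where "(k\<^sub>0, shifts, bases) \<in> set es" by auto
  then have "class_ok q (k\<^sub>0, shifts, bases)" using t by (auto simp: table_ok_def list_all_iff)
  then have c: "list_all (shift_ok q k\<^sub>0) shifts"
     "foldr gcd (map (\<lambda>(r, s). shift_of q k\<^sub>0 r s) shifts) 0 = shift_modulus q"
     "list_all (base_ok q) bases"
     "list_all (\<lambda>t. admissible q (k\<^sub>0 + q * t) \<longrightarrow>
        list_ex (\<lambda>(k, a, g). (k - (k\<^sub>0 + q * t)) mod (q * shift_modulus q) = 0) bases) [0..shift_modulus q - 1]"
    by (simp_all add: class_ok_def)
  have cop: "coprime k\<^sub>0 q" using \<open>gcd k\<^sub>0 q = 1\<close> by (simp add: coprime_iff_gcd_eq_1)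
  have sh: "is_shift q k\<^sub>0 (shift_modulus q) \<and> is_shift q k\<^sub>0 (- shift_modulus q)"
    using shift_ok_list[OF q cop c(1)] unfolding c(2) .
  have M: "shift_modulus q > 0" by (simp add: shift_modulus_def)
  \<comment> \<open>Reducing the quotient modulo the period places \<open>k\<close> among the
    finitely many candidates checked by the certificate.\<close>
  define t where "t = (k div q) mod shift_modulus q"
  have tm: "t \<in> set [0..shift_modulus q - 1]" using M by (simp add: t_def)
  have "k = k\<^sub>0 + q * (k div q)" by (simp add: k\<^sub>0_def)
  also have "k div q = t + shift_modulus q * (k div q div shift_modulus q)" by (simp add: t_def)
  finally have kt: "k = (k\<^sub>0 + q * t) + q * (shift_modulus q * (k div q div shift_modulus q))"
    by (simp only: distrib_left add.assoc)
  have "admissible q (k\<^sub>0 + q * t)" by (rule admissible_cong[OF kt k(2)])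
  then have "list_ex (\<lambda>(k, a, g). (k - (k\<^sub>0 + q * t)) mod (q * shift_modulus q) = 0) bases"
    using c(4) tm by (auto simp: list_all_iff)
  then obtain b a g where b: "(b, a, g) \<in> set bases" "(b - (k\<^sub>0 + q * t)) mod (q * shift_modulus q) = 0"
    by (auto simp: list_ex_iff)
  have bv: "is_value q b" using base_ok[OF q] b(1) c(3) by (auto simp: list_all_iff)
  obtain u where u: "b - (k\<^sub>0 + q * t) = q * shift_modulus q * u" using b(2) by (auto simp: mod_eq_0_iff_dvd)
  then have "b = k\<^sub>0 + q * (t + shift_modulus q * u)" by (simp add: algebra_simps)
  then have bc: "[b = k\<^sub>0] (mod q)" by (simp add: cong_def)
  have "k = b + q * ((k div q div shift_modulus q - u) * shift_modulus q)"
    using kt u by algebra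
  moreover have "is_value q (b + q * ((k div q div shift_modulus q - u) * shift_modulus q))"
    using is_shift_int_mult[OF sh] bc bv unfolding is_shift_def by blast
  ultimately show ?thesis by simp
qed

text \<open>One of \<open>k\<close> and \<open>- k\<close> has residue at most
  \<open>q div 2\<close>, and values and admissibility are symmetric under negation.\<close>

lemma table_ok_value:
  assumes q: "q > 0" and t: "table_ok q es" and k: "coprime k q" "admissible q k"
  shows "is_value q k"
proof (cases "k mod q \<le> q div 2")
  case True
  then show ?thesis using table_ok_small assms by blast
next
  case False
  have "(- k) mod q = (if k mod q = 0 then 0 else q - k mod q)" by (rule zmod_zminus1_eq_if)
  then have "(- k) mod q \<le> q div 2" using False q by auto
  then have "is_value q (- k)"
    using table_ok_small[OF q t] k admissible_uminus by simp
  then show ?thesis using is_value_uminus by fastforce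
qed

section \<open>Certificates for the individual denominators\<close>

lemma table_2: "table_ok 2
   [(1, [(2, 1)], [(3, 1, 2)])]"
  by code_simp

text \<open>For example, the shift \<open>(3, 1)\<close> is
  \<open>S(1, 9) - S(4, 9) = 56/9 + 16/9 = 8\<close>, and the bases are
  \<open>S(1, 6) = 10/3\<close> and \<open>S(2, 3) = -2/3\<close>. Their numerators differ by 12,
  which is not a multiple of \<open>3 * 8\<close>, so they start different orbits.\<close>

lemma table_3: "table_ok 3
   [(1, [(3, 1)], [(10, 1, 2), (-2, 2, 1)])]"
  by code_simp

lemma table_4: "table_ok 4
   [(1, [(4, 3)], [(21, 1, 2)])]"
  by code_simp

lemma table_5: "table_ok 5
   [(1, [(5, 1)], [(36, 1, 2), (-24, 22, 5)]), (2, [(5, 1)], [(12, 1, 1), (-48, 23, 5)])]"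
  by code_simp

lemma table_6: "table_ok 6
   [(1, [(6, 1), (6, 5)], [(55, 1, 2)])]"
  by code_simp

lemma table_7: "table_ok 7
   [(1, [(5, 12)], [(78, 1, 2), (-6, 5, 1)]), (2, [(21, 13)], [(30, 1, 1), (-54, 83, 13)]),
    (3, [(10, 3)], [(-102, 33, 5), (-18, 11, 2)])]"
  by code_simp

lemma table_8: "table_ok 8
   [(1, [(8, 1), (8, 3)], [(105, 1, 2)]), (3, [(8, 3), (8, 7)], [(195, 3, 10)])]"
  by code_simp

lemma table_9: "table_ok 9
   [(1, [(3, 2)], [(136, 1, 2)]), (2, [(9, 8)], [(56, 1, 1)]), (4, [(3, 4)], [(-176, 43, 5)])]"
  by code_simp

lemma table_10: "table_ok 10
   [(1, [(6, 7)], [(171, 1, 2)]), (3, [(2, 7), (8, 23)], [(-297, 97, 10)])]"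
  by code_simp

lemma table_11: "table_ok 11
   [(1, [(7, 31), (11, 1)], [(78, 239, 26), (210, 1, 2)]), (2, [(5, 8)], [(90, 1, 1), (-42, 19, 2)]),
    (3, [(5, 2)], [(-162, 52, 5), (-30, 9, 1)]), (4, [(11, 1), (14, 3)], [(378, 3, 10), (-18, 8, 1)]),
    (5, [(9, 25)], [(126, 13, 17), (-270, 53, 5)])]"
  by code_simp

lemma table_12: "table_ok 12
   [(1, [(12, 1), (12, 5)], [(253, 1, 2)]), (5, [(12, 1), (12, 7)], [(53, 5, 2)])]"
  by code_simp

lemma table_13: "table_ok 13
   [(1, [(5, 2)], [(-168, 161, 13), (-12, 10, 1)]), (2, [(9, 32)], [(132, 1, 1), (-24, 19, 2)]),
    (3, [(11, 9)], [(-192, 123, 10), (-36, 53, 5)]), (4, [(5, 22)], [(-516, 127, 10), (-48, 11, 1)]),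
    (5, [(9, 4)], [(96, 18, 13), (252, 3, 5)]), (6, [(13, 1), (14, 3)], [(84, 3, 2), (-384, 63, 5)])]"
  by code_simp

lemma table_14: "table_ok 14
   [(1, [(2, 3)], [(351, 1, 2)]), (3, [(4, 5), (10, 3)], [(-81, 25, 2)]),
    (5, [(6, 17), (6, 23)], [(621, 3, 10)])]"
  by code_simp

lemma table_15: "table_ok 15
   [(1, [(6, 17)], [(406, 1, 2), (-14, 58, 5)]), (2, [(12, 13)], [(2, 103, 10), (182, 1, 1)]),
    (4, [(6, 13), (9, 17)], [(-86, 67, 5), (-26, 19, 2)]), (7, [(3, 7)], [(142, 17, 10), (-38, 11, 1)])]"
  by code_simp

lemma table_16: "table_ok 16
   [(1, [(8, 11)], [(465, 1, 2)]), (3, [(8, 3), (8, 5)], [(387, 7, 10)]),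
    (5, [(8, 5), (8, 11)], [(-795, 157, 10)]), (7, [(8, 3), (8, 5)], [(135, 3, 2)])]"
  by code_simp

lemma table_17: "table_ok 17
   [(1, [(9, 4)], [(528, 1, 2), (-84, 78, 5)]), (2, [(27, 37)], [(36, 190, 13), (240, 1, 1)]),
    (3, [(16, 99)], [(-660, 216, 13), (-48, 25, 2)]), (4, [(5, 3)], [(-336, 127, 10), (-132, 31, 2)]),
    (5, [(13, 23)], [(192, 225, 17), (-12, 12, 1)]), (6, [(7, 30)], [(108, 5, 2), (-96, 15, 1)]),
    (7, [(7, 24)], [(24, 137, 10), (-996, 418, 25)]), (8, [(11, 105)], [(-672, 83, 5), (-60, 14, 1)])]"
  by code_simp

lemma table_18: "table_ok 18
   [(1, [(6, 5), (6, 7)], [(595, 1, 2)]), (5, [(6, 11), (6, 13)], [(-2245, 893, 50)]),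
    (7, [(6, 5), (6, 7)], [(-425, 173, 10)])]"
  by code_simp

lemma table_19: "table_ok 19
   [(1, [(10, 3), (11, 93)], [(666, 1, 2), (-18, 12, 1)]), (2, [(5, 3)], [(78, 72, 5), (306, 1, 1)]),
    (3, [(5, 12)], [(630, 8, 13), (-54, 16, 1)]), (4, [(17, 10)], [(42, 153, 10), (-186, 88, 5)]),
    (5, [(13, 2), (13, 9)], [(1506, 4, 17), (-90, 33, 2)]), (6, [(7, 26)], [(6, 29, 2), (-1134, 187, 10)]),
    (7, [(7, 10)], [(558, 3, 5), (-126, 17, 1)]), (8, [(7, 5)], [(198, 3, 2), (-30, 77, 5)]),
    (9, [(16, 29)], [(66, 4, 1), (-162, 293, 17)])]"
  by code_simp

lemma table_20: "table_ok 20
   [(1, [(4, 13)], [(741, 1, 2)]), (3, [(8, 23), (12, 7)], [(-177, 183, 10)]),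
    (7, [(8, 17), (12, 13)], [(1287, 3, 10)]), (9, [(4, 7), (16, 3)], [(69, 9, 2)])]"
  by code_simp

lemma table_21: "table_ok 21
   [(1, [(9, 16)], [(-104, 97, 5), (-20, 17, 1)]), (2, [(15, 16)], [(380, 1, 1), (-544, 265, 13)]),
    (4, [(3, 5)], [(4, 88, 5), (-80, 31, 2)]), (5, [(6, 17)], [(68, 190, 13), (-16, 13, 1)]),
    (8, [(9, 2), (9, 10)], [(-160, 19, 1), (-76, 83, 5)]), (10, [(3, 10)], [(-116, 37, 2), (-1040, 103, 5)])]"
  by code_simp

lemma table_22: "table_ok 22
   [(1, [(10, 19)], [(903, 1, 2)]), (3, [(6, 17)], [(531, 13, 10)]), (5, [(2, 15), (8, 9)], [(555, 21, 26)]),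
    (7, [(8, 7), (10, 13)], [(183, 5, 2)]), (9, [(2, 9), (6, 19)], [(273, 3, 2)])]"
  by code_simp

lemma table_23: "table_ok 23
   [(1, [(5, 3)], [(162, 226, 13), (990, 1, 2)]), (2, [(30, 37)], [(186, 452, 29), (462, 1, 1)]),
    (3, [(7, 19), (11, 2)], [(762, 21, 26), (-66, 39, 2)]), (4, [(5, 33)], [(786, 7, 10), (-42, 18, 1)]),
    (5, [(11, 51)], [(1362, 5, 13), (-18, 29, 2)]), (6, [(11, 16)], [(6, 16, 1), (-270, 43, 2)]),
    (7, [(7, 30)], [(30, 35, 2), (-798, 112, 5)]), (8, [(7, 11)], [(1710, 3, 10), (330, 7, 5)]),
    (9, [(13, 17)], [(78, 47, 13), (-198, 21, 1)]), (10, [(9, 52), (11, 146)], [(102, 4, 1), (378, 21, 17)]),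
    (11, [(10, 43), (13, 3)], [(126, 3, 1), (-1254, 113, 5)])]"
  by code_simp

lemma table_24: "table_ok 24
   [(1, [(24, 1), (24, 7)], [(1081, 1, 2)]), (5, [(24, 5), (24, 7)], [(461, 13, 10)]),
    (7, [(24, 1), (24, 5)], [(-161, 43, 2)]), (11, [(24, 1), (24, 5)], [(731, 7, 10)])]"
  by code_simp

lemma table_25: "table_ok 25
   [(1, [(5, 36)], [(1176, 1, 2)]), (2, [(15, 11)], [(552, 1, 1)]), (3, [(5, 4)], [(-72, 102, 5)]),
    (4, [(5, 14)], [(-96, 92, 5)]), (6, [(5, 9)], [(-144, 97, 5)]), (7, [(5, 21)], [(-168, 112, 5)]),
    (8, [(5, 4)], [(-192, 113, 5)]), (9, [(5, 14)], [(984, 3, 5)]), (11, [(15, 79)], [(336, 8, 5)]),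
    (12, [(5, 21)], [(-1488, 123, 5)])]"
  by code_simp

lemma table_26: "table_ok 26
   [(1, [(6, 17)], [(1275, 1, 2)]), (3, [(6, 19)], [(-777, 253, 10)]),
    (5, [(2, 21), (4, 9)], [(-177, 233, 10)]), (7, [(10, 19)], [(-357, 49, 2)]),
    (9, [(2, 15), (8, 9)], [(2193, 3, 10)]), (11, [(4, 19), (10, 3)], [(141, 7, 2)])]"
  by code_simp

lemma table_27: "table_ok 27
   [(1, [(3, 4)], [(1378, 1, 2), (-26, 593, 25)]), (2, [(3, 5)], [(650, 1, 1), (-106, 629, 26)]),
    (4, [(6, 7), (9, 64)], [(490, 73, 41), (1246, 8, 13)]), (5, [(6, 31)], [(518, 8, 5), (-1750, 346, 13)]),
    (7, [(3, 11)], [(3058, 4, 17), (-938, 263, 10)]), (8, [(3, 7)], [(278, 5, 2), (2546, 7, 25)]),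
    (10, [(12, 29)], [(-5822, 1747, 65), (-1826, 905, 34)]),
    (11, [(3, 5), (9, 71)], [(38, 404, 17), (-286, 25, 1)]),
    (13, [(3, 13)], [(2254, 17, 58), (-1742, 133, 5)])]"
  by code_simp

lemma table_28: "table_ok 28
   [(1, [(12, 19)], [(1485, 1, 2)]), (3, [(4, 11)], [(-165, 51, 2)]),
    (5, [(8, 25), (20, 3)], [(537, 17, 10)]), (9, [(8, 9), (8, 17), (20, 11)], [(-2511, 277, 10)]),
    (11, [(4, 3), (4, 9)], [(459, 3, 2)]), (13, [(12, 17)], [(69, 13, 2)])]"
  by code_simp

lemma table_29: "table_ok 29
   [(1, [(7, 3), (11, 80)], [(1596, 1, 2), (-144, 253, 10)]), (2, [(9, 7)], [(756, 1, 1), (-288, 137, 5)]),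
    (3, [(11, 9)], [(-1128, 369, 13), (-84, 25, 1)]),
    (4, [(7, 53), (19, 4)], [(816, 21, 17), (-228, 267, 10)]),
    (5, [(9, 56)], [(-372, 281, 13), (-24, 47, 2)]), (6, [(9, 49)], [(180, 233, 10), (-168, 43, 2)]),
    (7, [(9, 41)], [(36, 20, 1), (384, 27, 10)]), (8, [(5, 22)], [(-456, 55, 2), (-108, 122, 5)]),
    (9, [(7, 12)], [(-1296, 142, 5), (-252, 53, 2)]), (10, [(9, 76)], [(300, 82, 25), (-48, 21, 1)]),
    (11, [(11, 41)], [(156, 5, 1), (-888, 438, 17)]), (12, [(7, 11)], [(12, 117, 5), (-336, 27, 1)]),
    (13, [(13, 46)], [(216, 3, 1), (-132, 51, 2)]), (14, [(14, 39)], [(-2016, 143, 5), (-276, 668, 25)])]"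
  by code_simp

lemma table_30: "table_ok 30
   [(1, [(6, 17)], [(1711, 1, 2)]), (7, [(12, 23), (18, 7)], [(547, 17, 10)]),
    (11, [(6, 7), (6, 17)], [(161, 11, 2)]), (13, [(12, 17), (18, 13)], [(133, 47, 10)])]"
  by code_simp

lemma table_31: "table_ok 31
   [(1, [(11, 57), (13, 121)], [(1830, 1, 2), (-30, 26, 1)]), (2, [(15, 13)], [(870, 1, 1), (-246, 643, 25)]),
    (3, [(10, 13)], [(-462, 148, 5), (-90, 20, 1)]),
    (4, [(11, 114), (14, 79)], [(-678, 734, 37), (-1050, 514, 17)]),
    (5, [(7, 4), (9, 2)], [(222, 330, 13), (594, 12, 5)]), (6, [(5, 13)], [(6, 19, 1), (-366, 247, 10)]),
    (7, [(5, 23)], [(162, 278, 13), (-210, 28, 1)]), (8, [(7, 17)], [(318, 7, 2), (-54, 766, 29)]),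
    (9, [(7, 74)], [(102, 47, 2), (474, 17, 10)]), (10, [(11, 16)], [(-486, 147, 5), (-3090, 307, 10)]),
    (11, [(9, 11)], [(1530, 3, 5), (-1074, 785, 26)]), (12, [(5, 102)], [(198, 4, 1), (570, 3, 2)]),
    (13, [(7, 9)], [(-390, 29, 1), (-18, 138, 5)]), (14, [(11, 50)], [(138, 11, 2), (1254, 7, 10)]),
    (15, [(19, 135)], [(294, 5, 2), (-78, 24, 1)])]"
  by code_simp

lemma table_32: "table_ok 32
   [(1, [(8, 3), (8, 5)], [(1953, 1, 2)]), (3, [(8, 13)], [(1251, 75, 58)]),
    (5, [(8, 5), (8, 19)], [(-795, 801, 26)]), (7, [(8, 11), (8, 13)], [(-2553, 1075, 34)]),
    (9, [(8, 35)], [(-567, 61, 2)]), (11, [(8, 11), (8, 13)], [(3339, 3, 10)]),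
    (13, [(8, 3), (8, 5)], [(-1395, 313, 10)]), (15, [(8, 11)], [(495, 47, 34)])]"
  by code_simp

lemma table_33: "table_ok 33
   [(1, [(12, 25)], [(-428, 320, 13), (2080, 1, 2)]), (2, [(9, 20)], [(-196, 307, 10), (992, 1, 1)]),
    (4, [(3, 7)], [(-260, 61, 2), (-128, 29, 1)]), (5, [(3, 13)], [(-160, 497, 17), (-292, 152, 5)]),
    (7, [(3, 8)], [(-224, 49, 2), (-92, 26, 1)]), (8, [(15, 19)], [(-520, 313, 10), (-124, 28, 1)]),
    (10, [(15, 17)], [(-188, 43, 2), (-320, 395, 13)]), (13, [(6, 29)], [(-416, 263, 10), (-20, 23, 1)]),
    (14, [(6, 17)], [(-448, 31, 1), (740, 13, 10)]), (16, [(3, 16)], [(-2624, 163, 5), (1204, 13, 17)])]"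
  by code_simp

lemma table_34: "table_ok 34
   [(1, [(2, 5)], [(2211, 1, 2)]), (3, [(12, 5), (14, 13)], [(-99, 59, 2)]), (5, [(2, 9)], [(-369, 801, 26)]),
    (7, [(2, 23), (6, 13)], [(-231, 307, 10)]), (9, [(4, 5), (6, 11)], [(-1521, 333, 10)]),
    (11, [(4, 9), (6, 7)], [(-363, 63, 2)]), (13, [(2, 21)], [(693, 3, 2)]),
    (15, [(4, 21), (10, 23)], [(627, 217, 34)])]"
  by code_simp

lemma table_35: "table_ok 35
   [(1, [(5, 4)], [(246, 1877, 65), (2346, 1, 2)]), (2, [(7, 8)], [(1122, 1, 1), (-138, 317, 10)]),
    (3, [(10, 101)], [(318, 197, 10), (-102, 152, 5)]), (4, [(10, 11)], [(1194, 13, 10), (-66, 59, 2)]),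
    (6, [(5, 16)], [(6, 41, 2), (-414, 2127, 65)]), (8, [(5, 11)], [(78, 24, 1), (498, 13, 5)]),
    (9, [(14, 27)], [(5154, 4, 17), (-306, 277, 10)]), (11, [(10, 11)], [(186, 237, 10), (-234, 61, 2)]),
    (12, [(7, 13)], [(222, 6, 1), (4002, 3, 10)]), (13, [(5, 9)], [(258, 4, 1), (-162, 127, 5)]),
    (16, [(14, 43)], [(366, 23, 10), (-54, 81, 17)]), (17, [(7, 8)], [(-2958, 173, 5), (-18, 267, 10)])]"
  by code_simp

lemma table_36: "table_ok 36
   [(1, [(12, 11), (12, 13)], [(2485, 1, 2)]), (5, [(12, 7), (12, 23)], [(-8995, 1793, 50)]),
    (7, [(12, 11), (12, 13)], [(-857, 347, 10)]), (11, [(12, 5), (12, 7)], [(1775, 7, 10)]),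
    (13, [(12, 11), (12, 13)], [(-635, 1693, 50)]), (17, [(12, 5), (12, 7)], [(413, 5, 2)])]"
  by code_simp

lemma table_37: "table_ok 37
   [(1, [(9, 7)], [(408, 540, 17), (-36, 27, 1)]), (2, [(10, 93), (11, 3)], [(1260, 1, 1), (-72, 61, 2)]),
    (3, [(5, 62), (7, 26)], [(-552, 177, 5), (-108, 408, 13)]),
    (4, [(11, 13)], [(-588, 1032, 29), (-144, 24, 1)]),
    (5, [(13, 127), (13, 141)], [(2928, 1007, 34), (-180, 33, 1)]),
    (6, [(5, 57)], [(2004, 7, 10), (-216, 424, 13)]), (7, [(13, 18)], [(1080, 13, 10), (-252, 67, 2)]),
    (8, [(13, 94)], [(-1620, 941, 26), (-288, 55, 2)]), (9, [(9, 13)], [(-1656, 277, 10), (-324, 34, 1)]),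
    (10, [(9, 11)], [(84, 743, 25), (528, 5, 2)]), (11, [(9, 43)], [(48, 51, 2), (-396, 343, 10)]),
    (12, [(11, 26)], [(900, 7, 5), (-432, 868, 25)]), (13, [(5, 53)], [(2196, 3, 5), (-912, 463, 13)]),
    (14, [(7, 9)], [(384, 13, 5), (-60, 30, 1)]), (15, [(7, 51)], [(348, 27, 5), (-96, 29, 1)]),
    (16, [(5, 8)], [(-576, 35, 1), (-132, 65, 2)]), (17, [(10, 3), (14, 11)], [(276, 47, 13), (-168, 32, 1)]),
    (18, [(5, 47)], [(-3312, 183, 5), (-204, 63, 2)])]"
  by code_simp

lemma table_38: "table_ok 38
   [(1, [(4, 7), (10, 3)], [(2775, 1, 2)]), (3, [(6, 43)], [(3, 837, 26)]),
    (5, [(2, 3), (4, 23)], [(-375, 71, 2)]), (7, [(4, 13), (6, 7)], [(-1095, 1211, 34)]),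
    (9, [(2, 5), (8, 31)], [(465, 7, 2)]), (11, [(6, 13)], [(-825, 73, 2)]),
    (13, [(12, 7), (14, 17)], [(279, 9, 2)]), (15, [(2, 17), (12, 73)], [(243, 37, 10)]),
    (17, [(2, 11), (4, 17)], [(1917, 7, 10)])]"
  by code_simp

lemma table_39: "table_ok 39
   [(1, [(3, 5)], [(2926, 1, 2), (-38, 23, 1)]), (2, [(9, 67)], [(-310, 421, 13), (1406, 1, 1)]),
    (4, [(9, 47)], [(1330, 17, 10), (-74, 32, 1)]), (5, [(9, 29)], [(122, 152, 5), (-34, 337, 10)]),
    (7, [(3, 7), (3, 37)], [(46, 49, 2), (1138, 7, 5)]),
    (8, [(9, 10), (9, 22)], [(398, 313, 10), (554, 17, 5)]),
    (10, [(6, 11), (15, 22)], [(1258, 31, 26), (166, 142, 5)]),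
    (11, [(3, 10)], [(50, 424, 13), (-106, 25, 1)]), (14, [(6, 17)], [(326, 4, 1), (170, 53, 2)]),
    (16, [(6, 19), (6, 67)], [(94, 157, 5), (250, 109, 26)]),
    (17, [(15, 46)], [(-178, 43, 10), (-646, 37, 1)]), (19, [(3, 19)], [(-3686, 193, 5), (-98, 61, 2)])]"
  by code_simp

lemma table_40: "table_ok 40
   [(1, [(16, 27)], [(3081, 1, 2)]), (3, [(8, 13), (8, 23)], [(-597, 383, 10)]),
    (7, [(8, 7), (8, 17)], [(-2433, 1339, 34)]), (9, [(16, 3), (16, 13)], [(489, 9, 2)]),
    (11, [(16, 27), (16, 37)], [(-1149, 387, 10)]), (13, [(8, 23), (8, 33)], [(-5187, 397, 10)]),
    (17, [(8, 7), (8, 27)], [(537, 89, 34)]), (19, [(16, 3), (16, 13)], [(579, 27, 10)])]"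
  by code_simp

lemma table_41: "table_ok 41
   [(1, [(11, 3), (13, 200)], [(3240, 1, 2), (-204, 193, 5)]), (2, [(15, 38)], [(84, 421, 13), (1560, 1, 1)]),
    (3, [(13, 18)], [(-612, 153, 5), (-120, 36, 1)]),
    (4, [(7, 5), (13, 3)], [(-816, 982, 25), (1644, 47, 34)]), (5, [(9, 11)], [(456, 582, 17), (-36, 29, 1)]),
    (6, [(5, 38), (10, 43)], [(-732, 1449, 37), (-240, 37, 1)]),
    (7, [(5, 28)], [(48, 25, 1), (-444, 473, 13)]), (8, [(5, 7)], [(-648, 327, 10), (828, 47, 17)]),
    (9, [(5, 52)], [(132, 28, 1), (-360, 61, 2)]), (10, [(7, 65)], [(-564, 192, 5), (-72, 367, 10)]),
    (11, [(10, 87)], [(1200, 21, 17), (-2244, 403, 10)]), (12, [(7, 16)], [(-972, 79, 2), (504, 33, 10)]),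
    (13, [(9, 101)], [(300, 6, 1), (792, 23, 10)]), (14, [(16, 125)], [(-888, 512, 13), (-396, 75, 2)]),
    (15, [(9, 94)], [(384, 18, 5), (-108, 30, 1)]), (16, [(5, 18)], [(180, 13, 2), (-312, 163, 5)]),
    (17, [(7, 179)], [(468, 3, 1), (-24, 59, 2)]), (18, [(9, 25)], [(-720, 39, 1), (-228, 65, 2)]),
    (19, [(5, 33)], [(1044, 7, 5), (552, 5, 2)]), (20, [(13, 119)], [(-636, 393, 10), (-4080, 203, 5)])]"
  by code_simp

lemma table_42: "table_ok 42
   [(1, [(12, 11), (30, 17)], [(3403, 1, 2)]), (5, [(6, 17), (6, 23)], [(-457, 397, 10)]),
    (11, [(18, 17), (18, 23)], [(683, 5, 2)]), (13, [(12, 23), (30, 11)], [(307, 13, 2)]),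
    (17, [(18, 5), (18, 11)], [(269, 11, 2)]), (19, [(6, 17), (6, 23)], [(943, 17, 10)])]"
  by code_simp

lemma table_43: "table_ok 43
   [(1, [(7, 4), (13, 80)], [(3570, 1, 2), (-42, 37, 1)]),
    (2, [(10, 107), (11, 167)], [(174, 163, 5), (1722, 1, 1)]),
    (3, [(17, 20)], [(390, 313, 10), (-126, 183, 5)]), (4, [(9, 11)], [(90, 59, 2), (-426, 202, 5)]),
    (5, [(7, 66), (13, 112)], [(-726, 608, 17), (-210, 28, 1)]),
    (6, [(5, 7)], [(1038, 12, 5), (-510, 81, 2)]), (7, [(7, 68)], [(1254, 8, 5), (-294, 540, 17)]),
    (8, [(5, 13)], [(1470, 32, 25), (-78, 35, 1)]), (9, [(11, 123)], [(138, 173, 5), (4782, 5, 13)]),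
    (10, [(11, 371), (23, 9)], [(354, 775, 26), (-162, 34, 1)]),
    (11, [(9, 79)], [(2118, 323, 10), (-462, 40, 1)]), (12, [(11, 53)], [(270, 65, 2), (-246, 38, 1)]),
    (13, [(5, 38)], [(2550, 7, 10), (-30, 31, 1)]), (14, [(9, 13)], [(-6006, 427, 10), (-330, 75, 2)]),
    (15, [(9, 25)], [(402, 4, 1), (-114, 61, 2)]), (16, [(5, 18)], [(1134, 3, 2), (-2478, 1057, 25)]),
    (17, [(9, 113)], [(-714, 343, 10), (-1230, 208, 5)]),
    (18, [(7, 185)], [(-1014, 403, 10), (534, 106, 17)]), (19, [(11, 31)], [(-798, 41, 1), (-282, 502, 13)]),
    (20, [(9, 101)], [(450, 44, 13), (-66, 33, 1)]), (21, [(5, 8)], [(-882, 1087, 26), (-366, 79, 2)])]"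
  by code_simp

lemma table_44: "table_ok 44
   [(1, [(4, 13)], [(3741, 1, 2)]), (3, [(4, 7), (4, 29)], [(-129, 387, 10)]),
    (5, [(8, 17), (20, 3)], [(2601, 21, 26)]), (7, [(8, 25), (12, 17)], [(-213, 75, 2)]),
    (9, [(16, 3), (20, 13)], [(-387, 81, 2)]), (13, [(16, 59), (20, 9)], [(-1131, 85, 2)]),
    (15, [(8, 19), (12, 5)], [(-645, 83, 2)]), (17, [(8, 49), (20, 19)], [(369, 177, 26)]),
    (19, [(4, 15)], [(-1521, 427, 10)]), (21, [(4, 17)], [(21, 21, 2)])]"
  by code_simp

lemma table_45: "table_ok 45
   [(1, [(6, 7), (9, 8)], [(136, 1007, 25), (3916, 1, 2)]), (2, [(3, 7)], [(1892, 1, 1), (-88, 403, 10)]),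
    (4, [(9, 17), (9, 37)], [(-356, 551, 13), (-896, 217, 5)]),
    (7, [(3, 2), (12, 13)], [(-308, 41, 1), (1312, 17, 10)]),
    (8, [(12, 97), (15, 4)], [(1088, 43, 25), (1628, 41, 29)]),
    (11, [(6, 47), (9, 8)], [(416, 37, 10), (-8404, 761, 17)]),
    (13, [(12, 67)], [(508, 214, 41), (688, 13, 5)]), (14, [(9, 37)], [(464, 17, 5), (1004, 31, 13)]),
    (16, [(9, 28), (9, 118)], [(-1424, 437, 10), (-524, 676, 17)]),
    (17, [(3, 32)], [(-1288, 1093, 25), (-1108, 1259, 29)]),
    (19, [(6, 23), (9, 17)], [(-7136, 1118, 25), (-116, 79, 2)]),
    (22, [(3, 22)], [(-4928, 223, 5), (652, 91, 41)])]"
  by code_simp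

lemma table_46: "table_ok 46
   [(1, [(2, 17)], [(4095, 1, 2)]), (3, [(6, 31), (12, 35)], [(-273, 85, 2)]), (5, [(2, 11)], [(-87, 75, 2)]),
    (7, [(2, 37), (4, 15)], [(-177, 81, 2)]), (9, [(2, 31), (4, 21)], [(-405, 413, 10)]),
    (11, [(4, 19), (6, 79)], [(747, 73, 26)]), (13, [(2, 7)], [(-14937, 2293, 50)]),
    (15, [(4, 37), (6, 19)], [(-6885, 457, 10)]), (17, [(6, 11), (8, 65)], [(1305, 3, 2)]),
    (19, [(14, 67)], [(-2925, 453, 10)]), (21, [(10, 7), (10, 13)], [(711, 5, 2)])]"
  by code_simp

lemma table_47: "table_ok 47
   [(1, [(7, 109), (13, 3)], [(330, 463, 13), (4278, 1, 2)]),
    (2, [(27, 260)], [(378, 1339, 34), (2070, 1, 1)]),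
    (3, [(9, 121), (11, 207)], [(-702, 1018, 25), (-138, 83, 2)]),
    (4, [(5, 7)], [(474, 540, 17), (-90, 37, 1)]), (5, [(5, 92), (7, 38)], [(1650, 43, 25), (-42, 34, 1)]),
    (6, [(9, 25)], [(6, 36, 1), (-2814, 463, 10)]), (7, [(9, 13)], [(54, 55, 2), (-510, 1139, 26)]),
    (8, [(9, 92)], [(102, 59, 2), (-462, 417, 10)]), (9, [(5, 8)], [(-5490, 606, 13), (-414, 187, 5)]),
    (10, [(7, 61)], [(198, 32, 1), (762, 105, 37)]), (11, [(5, 82)], [(-882, 427, 10), (-318, 1143, 29)]),
    (12, [(15, 43)], [(-834, 447, 10), (858, 5, 2)]), (13, [(9, 14)], [(342, 71, 2), (-222, 40, 1)]),
    (14, [(11, 3), (11, 97)], [(390, 6, 1), (-1302, 91, 2)]),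
    (15, [(13, 62)], [(438, 9, 2), (-3510, 232, 5)]), (16, [(10, 17)], [(486, 4, 1), (-1206, 227, 5)]),
    (17, [(7, 24)], [(534, 7, 2), (-30, 38, 1)]), (18, [(10, 43)], [(18, 33, 5), (582, 128, 29)]),
    (19, [(7, 12)], [(1194, 30, 17), (630, 3, 1)]), (20, [(13, 24)], [(114, 1690, 41), (678, 17, 5)]),
    (21, [(15, 113)], [(-966, 45, 1), (-2658, 2307, 50)]), (22, [(7, 31)], [(210, 140, 17), (774, 12, 5)]),
    (23, [(9, 11)], [(-5382, 233, 5), (-306, 42, 1)])]"
  by code_simp

lemma table_48: "table_ok 48
   [(1, [(24, 5), (24, 11)], [(4465, 1, 2)]), (5, [(24, 5), (24, 11)], [(2117, 13, 10)]),
    (7, [(24, 5), (24, 11)], [(-665, 91, 2)]), (11, [(24, 5), (24, 13)], [(443, 43, 10)]),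
    (13, [(24, 5), (24, 11)], [(-3107, 473, 10)]), (17, [(24, 5), (24, 13)], [(-559, 89, 2)]),
    (19, [(24, 11), (24, 13)], [(1123, 23, 10)]), (23, [(24, 5), (24, 11)], [(359, 11, 2)])]"
  by code_simp

lemma table_49: "table_ok 49
   [(1, [(7, 69), (19, 291)], [(-48, 31, 1)]), (2, [(15, 52)], [(2256, 1, 1)]),
    (3, [(7, 13)], [(-144, 81, 2)]), (4, [(7, 132), (11, 108)], [(-192, 61, 2)]),
    (5, [(7, 6), (13, 94)], [(-240, 423, 10)]), (6, [(7, 27)], [(-288, 32, 1)]),
    (8, [(5, 32)], [(-384, 45, 1)]), (9, [(7, 43), (13, 95)], [(744, 37, 10)]),
    (10, [(7, 13)], [(696, 9, 2)]), (11, [(7, 36)], [(-528, 73, 2)]), (12, [(13, 23)], [(600, 47, 10)]),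
    (13, [(5, 37)], [(-624, 46, 1)]), (15, [(7, 22)], [(456, 5, 1)]), (16, [(13, 19)], [(-7824, 487, 10)]),
    (17, [(7, 15)], [(-816, 93, 2)]), (18, [(7, 34)], [(1488, 3, 2)]),
    (19, [(7, 6), (13, 58)], [(1440, 17, 10)]), (20, [(7, 27)], [(216, 9, 1)]),
    (22, [(7, 20)], [(-1056, 47, 1)]), (23, [(13, 54)], [(72, 93, 10)]), (24, [(7, 13)], [(24, 79, 2)])]"
  by code_simp

lemma table_50: "table_ok 50
   [(1, [(10, 19), (10, 21)], [(4851, 1, 2)]), (3, [(10, 9), (10, 11)], [(-297, 433, 10)]),
    (7, [(2, 13)], [(-393, 453, 10)]), (9, [(4, 17), (10, 29)], [(1959, 13, 10)]),
    (11, [(10, 19), (10, 21)], [(1161, 23, 10)]), (13, [(10, 9), (10, 11)], [(-1287, 483, 10)]),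
    (17, [(8, 17), (10, 39)], [(8217, 3, 10)]), (19, [(6, 13), (6, 43)], [(969, 63, 10)]),
    (21, [(10, 19), (10, 21)], [(471, 73, 10)]), (23, [(10, 9), (10, 11)], [(423, 33, 10)])]"
  by code_simp

lemma table_51: "table_ok 51
   [(1, [(3, 28)], [(5050, 1, 2), (-50, 163, 5)]), (2, [(12, 19), (21, 13)], [(2450, 1, 1), (1022, 499, 13)]),
    (4, [(6, 19)], [(-1118, 574, 17), (-98, 79, 2)]), (5, [(3, 29)], [(-250, 46, 1), (-454, 218, 5)]),
    (7, [(6, 13), (15, 11)], [(-758, 820, 17), (-146, 443, 10)]),
    (8, [(3, 8)], [(110, 31, 1), (-94, 460, 13)]),
    (10, [(6, 55), (15, 23)], [(-398, 625, 17), (-1010, 407, 10)]),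
    (11, [(6, 41)], [(-754, 487, 10), (-142, 43, 1)]), (13, [(6, 83)], [(-242, 91, 2), (10978, 4, 17)]),
    (14, [(3, 13)], [(422, 77, 2), (-1414, 1645, 34)]),
    (16, [(3, 14), (15, 146)], [(1750, 7, 5), (-494, 67, 2)]),
    (19, [(12, 53)], [(70, 35, 1), (-950, 632, 13)]), (20, [(3, 4), (9, 26)], [(6650, 13, 34), (-82, 83, 2)]),
    (22, [(12, 55)], [(22, 232, 5), (-182, 44, 1)]), (23, [(6, 73)], [(-1150, 49, 1), (686, 37, 10)]),
    (25, [(3, 8)], [(178, 11, 1), (382, 86, 13)])]"
  by code_simp

lemma table_52: "table_ok 52
   [(1, [(8, 11), (20, 9)], [(5253, 1, 2)]), (3, [(12, 73)], [(-465, 487, 10)]),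
    (5, [(4, 61)], [(-567, 493, 10)]), (7, [(12, 17), (12, 29)], [(-357, 95, 2)]),
    (9, [(4, 21), (8, 9)], [(-927, 497, 10)]), (11, [(4, 15), (4, 19)], [(843, 7, 2)]),
    (15, [(4, 7), (4, 11)], [(483, 11, 2)]), (17, [(4, 5), (4, 31)], [(-8823, 517, 10)]),
    (19, [(12, 23)], [(1683, 3, 2)]), (21, [(4, 29)], [(489, 53, 10)]),
    (23, [(12, 5), (12, 31)], [(3663, 7, 10)]), (25, [(8, 41), (20, 3)], [(-27, 25, 2)])]"
  by code_simp

lemma table_53: "table_ok 53
   [(1, [(5, 67)], [(5460, 1, 2), (-264, 393, 10)]), (2, [(9, 11)], [(2652, 1, 1), (-528, 253, 5)]),
    (3, [(15, 248)], [(-792, 1305, 26), (-156, 218, 5)]), (4, [(9, 13)], [(-1056, 198, 5), (-420, 99, 2)]),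
    (5, [(5, 2), (7, 135)], [(1860, 81, 34), (-48, 75, 2)]),
    (6, [(19, 17), (19, 28)], [(1596, 57, 25), (-4128, 681, 13)]),
    (7, [(13, 18)], [(1332, 44, 13), (-1848, 1293, 25)]), (8, [(9, 22)], [(-840, 101, 2), (-204, 46, 1)]),
    (9, [(5, 78)], [(168, 403, 10), (-468, 49, 1)]), (10, [(10, 43)], [(540, 81, 17), (-96, 41, 1)]),
    (11, [(9, 83)], [(276, 36, 1), (7272, 5, 13)]),
    (12, [(11, 101), (13, 9)], [(1284, 38, 17), (-624, 79, 2)]),
    (13, [(5, 8)], [(-888, 503, 10), (-252, 42, 1)]), (14, [(5, 93)], [(120, 73, 2), (756, 752, 17)]),
    (15, [(11, 116)], [(492, 6, 1), (2400, 701, 17)]), (16, [(7, 116)], [(228, 37, 5), (-408, 48, 1)]),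
    (17, [(9, 16)], [(-4488, 262, 5), (-1308, 513, 10)]),
    (18, [(13, 46), (13, 197)], [(336, 32, 5), (-1572, 1282, 25)]),
    (19, [(9, 61)], [(1344, 162, 29), (-564, 97, 2)]), (20, [(7, 94)], [(444, 11, 2), (-192, 39, 1)]),
    (21, [(11, 383)], [(180, 17, 2), (816, 3, 1)]), (22, [(7, 19)], [(1824, 18, 13), (-84, 93, 2)]),
    (23, [(9, 284)], [(288, 829, 17), (924, 13, 5)]),
    (24, [(10, 27), (13, 69)], [(-1248, 51, 1), (660, 117, 37)]),
    (25, [(10, 103), (21, 19)], [(396, 47, 10), (-240, 45, 1)]),
    (26, [(9, 38)], [(132, 10, 1), (-6864, 263, 5)])]"
  by code_simp

lemma table_54: "table_ok 54
   [(1, [(6, 5), (6, 43)], [(5671, 1, 2)]), (5, [(6, 31), (6, 47)], [(32621, 11, 122)]),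
    (7, [(6, 25), (6, 41)], [(-3773, 533, 10)]), (11, [(6, 13), (6, 29)], [(-1555, 523, 10)]),
    (13, [(6, 7), (6, 23)], [(-1121, 2593, 50)]), (17, [(6, 11), (6, 49)], [(7415, 13, 34)]),
    (19, [(6, 5), (6, 43)], [(-1007, 103, 2)]), (23, [(6, 31), (6, 47)], [(-20713, 2693, 50)]),
    (25, [(6, 25), (6, 41)], [(835, 73, 26)])]"
  by code_simp

lemma table_55: "table_ok 55
   [(1, [(10, 59)], [(5886, 1, 2), (-54, 768, 25)]), (2, [(20, 61)], [(2862, 1, 1), (-438, 1201, 26)]),
    (3, [(5, 24)], [(-822, 2643, 50), (-162, 49, 1)]), (4, [(10, 39)], [(114, 79, 2), (774, 153, 5)]),
    (6, [(9, 158), (11, 12)], [(6, 233, 5), (-654, 1268, 25)]),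
    (7, [(10, 71)], [(1602, 12, 5), (-378, 36, 1)]), (8, [(5, 9)], [(21678, 7, 50), (-102, 39, 1)]),
    (9, [(5, 29)], [(174, 69, 2), (-486, 463, 10)]), (12, [(10, 19)], [(-2298, 1554, 29), (1002, 82, 25)]),
    (13, [(5, 19)], [(-2022, 1399, 26), (-42, 34, 1)]), (14, [(11, 23)], [(234, 157, 50), (-426, 228, 5)]),
    (16, [(19, 193)], [(10686, 7, 25), (-534, 258, 5)]), (17, [(13, 62)], [(402, 1093, 25), (-258, 248, 5)]),
    (18, [(10, 49)], [(18, 188, 5), (678, 4, 1)]), (19, [(5, 9)], [(294, 293, 50), (4914, 3, 5)]),
    (21, [(10, 51)], [(186, 21, 2), (-474, 1018, 25)]), (23, [(7, 17)], [(78, 191, 29), (-582, 1043, 25)]),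
    (24, [(5, 19)], [(354, 19, 2), (-1626, 527, 10)]), (26, [(10, 31)], [(246, 208, 5), (-414, 101, 2)]),
    (27, [(13, 37)], [(-7398, 273, 5), (-138, 1218, 25)])]"
  by code_simp

lemma table_56: "table_ok 56
   [(1, [(16, 37)], [(6105, 1, 2)]), (3, [(24, 17), (24, 23)], [(-1677, 547, 10)]),
    (5, [(8, 19), (8, 25)], [(2469, 17, 10)]), (9, [(8, 3), (8, 9)], [(8241, 13, 34)]),
    (11, [(24, 11), (24, 25)], [(1299, 27, 10)]), (13, [(16, 5), (16, 11)], [(1245, 57, 26)]),
    (15, [(16, 3), (16, 9)], [(-321, 99, 2)]), (17, [(24, 31), (24, 59)], [(-1887, 109, 2)]),
    (19, [(8, 5), (8, 25)], [(10323, 3, 10)]), (23, [(8, 3), (8, 9)], [(1815, 55, 34)]),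
    (25, [(24, 19), (24, 25)], [(1089, 5, 2)]), (27, [(16, 5), (16, 11)], [(699, 99, 26)])]"
  by code_simp

lemma table_57: "table_ok 57
   [(1, [(9, 16)], [(628, 778, 17), (-56, 50, 1)]), (2, [(9, 34)], [(-340, 487, 10), (3080, 1, 1)]),
    (4, [(12, 41)], [(4, 217, 5), (232, 1201, 26)]), (5, [(3, 11)], [(-280, 71, 2), (-1420, 553, 10)]),
    (7, [(6, 65)], [(64, 1781, 34), (-164, 47, 1)]), (8, [(6, 25)], [(8, 89, 2), (-220, 248, 5)]),
    (10, [(3, 10)], [(-332, 103, 2), (-560, 53, 1)]), (11, [(6, 35)], [(-388, 101, 2), (-616, 227, 5)]),
    (13, [(3, 14)], [(-728, 85, 2), (-956, 922, 17)]), (14, [(6, 97)], [(-3976, 427, 10), (1268, 5, 2)]),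
    (16, [(3, 25), (9, 17)], [(16, 41, 1), (-1580, 710, 13)]),
    (17, [(9, 4), (9, 14)], [(-268, 37, 1), (4520, 7, 10)]),
    (20, [(9, 16), (9, 35)], [(20, 46, 1), (-664, 854, 17)]), (22, [(6, 53)], [(5152, 8, 13), (-92, 44, 1)]),
    (23, [(12, 101)], [(-2200, 278, 5), (16724, 5, 26)]),
    (25, [(3, 5), (3, 43)], [(-260, 97, 2), (880, 55, 17)]),
    (26, [(6, 7), (6, 197)], [(-316, 1687, 34), (-1456, 55, 1)]),
    (28, [(3, 28)], [(484, 5, 1), (712, 7, 2)])]"
  by code_simp

lemma table_58: "table_ok 58
   [(1, [(4, 9), (18, 7)], [(6555, 1, 2)]), (3, [(6, 65)], [(177, 2651, 58)]),
    (5, [(6, 23)], [(-285, 105, 2)]), (7, [(6, 31)], [(1689, 27, 10)]),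
    (9, [(2, 7), (4, 19)], [(-1035, 111, 2)]), (11, [(2, 39), (8, 23)], [(939, 9, 2)]),
    (13, [(2, 11), (12, 83)], [(-741, 109, 2)]), (15, [(6, 37)], [(15, 1373, 26)]),
    (17, [(2, 41), (10, 13)], [(249, 1383, 26)]), (19, [(4, 65), (10, 27)], [(-11001, 577, 10)]),
    (21, [(2, 31), (4, 11)], [(2109, 3, 2)]), (23, [(4, 41), (6, 55)], [(429, 15, 2)]),
    (25, [(4, 43), (6, 41)], [(1185, 23, 10)]), (27, [(2, 13), (8, 31)], [(-5715, 1951, 34)])]"
  by code_simp

lemma table_59: "table_ok 59
   [(1, [(7, 5), (11, 4)], [(414, 1321, 41), (6786, 1, 2)]), (2, [(5, 7)], [(3306, 1, 1), (-234, 109, 2)]),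
    (3, [(10, 37)], [(-882, 1068, 25), (-174, 35, 1)]),
    (4, [(7, 2), (13, 307)], [(-822, 1747, 34), (-114, 50, 1)]),
    (5, [(11, 53), (14, 103)], [(3486, 31, 26), (-54, 48, 1)]), (6, [(9, 41)], [(6, 99, 2), (-702, 723, 13)]),
    (7, [(5, 38)], [(66, 45, 1), (-2058, 288, 5)]), (8, [(11, 126)], [(126, 34, 1), (3666, 803, 17)]),
    (9, [(9, 50)], [(186, 95, 2), (2310, 8, 5)]), (10, [(9, 148)], [(1662, 23, 10), (-462, 1143, 25)]),
    (11, [(10, 153)], [(-1110, 282, 5), (-402, 2256, 53)]), (12, [(5, 33)], [(366, 40, 1), (1074, 7, 2)]),
    (13, [(7, 16)], [(-990, 733, 13), (-282, 503, 10)]), (14, [(9, 83)], [(-930, 1607, 29), (-222, 51, 1)]),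
    (15, [(9, 121)], [(-2286, 749, 13), (-162, 242, 5)]), (16, [(15, 167)], [(606, 6, 1), (-1518, 1451, 26)]),
    (17, [(7, 143)], [(666, 5, 1), (-42, 73, 10)]), (18, [(7, 24)], [(18, 41, 1), (-2106, 115, 2)]),
    (19, [(11, 16)], [(-5586, 292, 5), (786, 4, 1)]), (20, [(13, 21)], [(11466, 3, 10), (-570, 103, 2)]),
    (21, [(11, 41)], [(-1218, 113, 2), (-510, 735, 17)]), (22, [(5, 32)], [(-1158, 262, 5), (966, 1321, 26)]),
    (23, [(9, 110)], [(-1098, 268, 5), (1026, 3, 1)]), (24, [(7, 87)], [(378, 7, 1), (2502, 13, 10)]),
    (25, [(5, 47)], [(438, 149, 17), (-270, 257, 5)]), (26, [(7, 95)], [(4746, 7, 10), (-210, 97, 2)]),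
    (27, [(14, 191)], [(558, 11, 2), (-1566, 57, 1)]), (28, [(5, 168)], [(-798, 1382, 25), (-90, 91, 2)]),
    (29, [(10, 23)], [(678, 43, 10), (-8526, 293, 5)])]"
  by code_simp

lemma table_60: "table_ok 60
   [(1, [(24, 23), (36, 7)], [(7021, 1, 2)]), (7, [(12, 23), (12, 43)], [(7, 503, 10)]),
    (11, [(24, 23), (36, 7)], [(971, 11, 2)]), (13, [(12, 7), (12, 17)], [(-1487, 533, 10)]),
    (17, [(12, 13), (12, 23)], [(-583, 553, 10)]), (19, [(24, 17), (36, 13)], [(379, 19, 2)]),
    (23, [(12, 37), (12, 47)], [(-1897, 583, 10)]), (29, [(24, 17), (36, 13)], [(-91, 29, 2)])]"
  by code_simp

section \<open>Assembling the equivalence\<close>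

lemmas tables =
  table_2 table_3 table_4 table_5 table_6 table_7 table_8 table_9 table_10 table_11 table_12
  table_13 table_14 table_15 table_16 table_17 table_18 table_19 table_20 table_21 table_22 table_23
  table_24 table_25 table_26 table_27 table_28 table_29 table_30 table_31 table_32 table_33 table_34
  table_35 table_36 table_37 table_38 table_39 table_40 table_41 table_42 table_43 table_44 table_45
  table_46 table_47 table_48 table_49 table_50 table_51 table_52 table_53 table_54 table_55 table_56
  table_57 table_58 table_59 table_60

lemma table_exists:
  assumes "2 \<le> q" "q \<le> 60"
  shows "\<exists>es. table_ok q es"
proof -
  have "q \<in> set [2..60]" using assms by (simp only: set_upto atLeastAtMost_iff simp_thms)
  also have "set [2..60] = {2, 3, 4, 5, 6, 7, 8, 9, 10, 11, 12, 13, 14, 15, 16, 17, 18, 19, 20, 21, 22, 23, 24, 25,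
      26, 27, 28, 29, 30, 31, 32, 33, 34, 35, 36, 37, 38, 39, 40, 41, 42, 43, 44, 45, 46,
      47, 48, 49, 50, 51, 52, 53, 54, 55, 56, 57, 58, 59, 60 :: int}"
    by code_simp
  finally have "q = 2 \<or> q = 3 \<or> q = 4 \<or> q = 5 \<or> q = 6 \<or> q = 7 \<or> q = 8 \<or> q = 9 \<or>
      q = 10 \<or> q = 11 \<or> q = 12 \<or> q = 13 \<or> q = 14 \<or> q = 15 \<or> q = 16 \<or> q = 17 \<or>
      q = 18 \<or> q = 19 \<or> q = 20 \<or> q = 21 \<or> q = 22 \<or> q = 23 \<or> q = 24 \<or> q = 25 \<or>
      q = 26 \<or> q = 27 \<or> q = 28 \<or> q = 29 \<or> q = 30 \<or> q = 31 \<or> q = 32 \<or> q = 33 \<or>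
      q = 34 \<or> q = 35 \<or> q = 36 \<or> q = 37 \<or> q = 38 \<or> q = 39 \<or> q = 40 \<or> q = 41 \<or>
      q = 42 \<or> q = 43 \<or> q = 44 \<or> q = 45 \<or> q = 46 \<or> q = 47 \<or> q = 48 \<or> q = 49 \<or>
      q = 50 \<or> q = 51 \<or> q = 52 \<or> q = 53 \<or> q = 54 \<or> q = 55 \<or> q = 56 \<or> q = 57 \<or>
      q = 58 \<or> q = 59 \<or> q = 60"
    by (simp only: insert_iff empty_iff simp_thms)
  then show ?thesis by (elim disjE) (simp_all only:, (rule exI, rule tables)+)
qed

lemma square_iff:
  fixes q :: nat
  assumes "2 \<le> q" "q \<le> 60" "odd q"
  shows "(\<exists>m. q = m\<^sup>2) \<longleftrightarrow> q = 9 \<or> q = 25 \<or> q = 49"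
proof
  assume "\<exists>m. q = m\<^sup>2"
  then obtain m where m: "q = m\<^sup>2" by blast
  have "m < 8"
  proof (rule ccontr)
    assume "\<not> m < 8"
    then have "8\<^sup>2 \<le> m\<^sup>2" by (intro power_mono) simp_all
    then show False using m assms(2) by simp
  qed
  then have "m = 0 \<or> m = 1 \<or> m = 2 \<or> m = 3 \<or> m = 4 \<or> m = 5 \<or> m = 6 \<or> m = 7" by linarith
  then show "q = 9 \<or> q = 25 \<or> q = 49" using m assms by auto
next
  assume "q = 9 \<or> q = 25 \<or> q = 49"
  then have "q = 3\<^sup>2 \<or> q = 5\<^sup>2 \<or> q = 7\<^sup>2" by simp
  then show "\<exists>m. q = m\<^sup>2" by blast
qed

lemma admissible_iff:
  fixes q :: nat and k :: int
  assumes "2 \<le> q" "q \<le> 60"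
  shows "admissible (int q) k \<longleftrightarrow>
    (\<not> 3 dvd q \<longrightarrow> [k = 0] (mod 3)) \<and>
    (\<not> 2 dvd q \<longrightarrow>
       (if [q = 3] (mod 4) then [k = 2] (mod 4)
        else if (\<exists>m :: nat. q = m\<^sup>2) then [k = 0] (mod 8)
        else [k = 0] (mod 4)))"
proof -
  have "int q mod 3 = 0 \<longleftrightarrow> 3 dvd q" "int q mod 2 = 0 \<longleftrightarrow> 2 dvd q" "int q mod 4 = 3 \<longleftrightarrow> [q = 3] (mod 4)"
    unfolding cong_def by presburger+
  moreover have "int q = 9 \<longleftrightarrow> q = 9" "int q = 25 \<longleftrightarrow> q = 25" "int q = 49 \<longleftrightarrow> q = 49" by linarith+
  ultimately show ?thesis
    using square_iff[OF assms] unfolding admissible_def by (auto simp: cong_def)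
qed

lemma value_admissible:
  assumes "2 \<le> q" "q \<le> 60" "coprime k q" "is_value q k"
  shows "admissible q k"
proof -
  have q: "q > 0" using assms(1) by simp
  have "k mod 3 = 0" if "q mod 3 \<noteq> 0"
    using value_mod_3[OF q assms(3,4)] that by (simp add: dvd_eq_mod_eq_0)
  moreover have "if q mod 4 = 3 then k mod 4 = 2
       else if q = 9 \<or> q = 25 \<or> q = 49 then k mod 8 = 0 else k mod 4 = 0" if "q mod 2 \<noteq> 0"
  proof -
    have o: "odd q" using that by presburger
    then have m: "q mod 4 = 1 \<or> q mod 4 = 3" by presburger
    have "k mod 8 = 0" if "q = 9 \<or> q = 25 \<or> q = 49"
      using value_mod_4(3)[OF q o assms(3,4), of 3] value_mod_4(3)[OF q o assms(3,4), of 5]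
        value_mod_4(3)[OF q o assms(3,4), of 7] that by auto
    then show ?thesis using m value_mod_4(1,2)[OF q o assms(3,4)] by auto
  qed
  ultimately show ?thesis unfolding admissible_def by blast
qed

theorem theorem2:
  fixes q :: nat and k :: int
  assumes "2 \<le> q" and "q \<le> 60" and "coprime k (int q)"
  shows "is_normalized_dedekind_value (real_of_int k / real q) \<longleftrightarrow>
    (\<not> 3 dvd q \<longrightarrow> [k = 0] (mod 3)) \<and>
    (\<not> 2 dvd q \<longrightarrow>
       (if [q = 3] (mod 4) then [k = 2] (mod 4)
        else if (\<exists>m :: nat. q = m\<^sup>2) then [k = 0] (mod 8)
        else [k = 0] (mod 4)))"
proof -
  have q: "2 \<le> int q" "int q \<le> 60" "int q > 0" using assms(1,2) by simp_all
  obtain es where es: "table_ok (int q) es" using table_exists[OF q(1,2)] by blast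
  have "is_value (int q) k \<longleftrightarrow> admissible (int q) k"
    using value_admissible[OF q(1,2) assms(3)] table_ok_value[OF q(3) es assms(3)] by blast
  then show ?thesis unfolding admissible_iff[OF assms(1,2)] is_value_def by simp
qed

end
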